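(* Let $(W,I)$ be a finite Coxeter group and $J_1,J_2\subset I$. Let $J'_1,\dots,J'_l$ be the connected components of $J_1$ and $J''_1,\dots,J''_{l'}$ the connected components of $J_2$ (in the Coxeter graph). Then $$J_1\star_I J_2=\bigsqcup_{1\le i\le l,\ 1\le i'\le l'}\bigl(J'_i\star_I J''_{i'}\bigr).$$
   Context: $W$ has simple reflections $s_i$ ($i\in I$). The monoid operation $\ast$ on $W$ is determined by $T'_xT'_y=T'_{x\ast y}$ in the $0$-Hecke algebra, where $T'_{s_i}$ satisfy $T'^2_{s_i}=T'_{s_i}$ and the braid relations, and $T'_w=T'_{s_{i_1}}\cdots T'_{s_{i_k}}$ for any reduced expression $w=s_{i_1}\cdots s_{i_k}$; equivalently $s_i\ast w$ is the Bruhat-larger of $w$ and $s_iw$. For $J\subset I$, $w_0^J$ is the longest element of $W_J=\langle s_j: j\in J\rangle$. For $J_1,J_2\subset I$, $J_1\star_I J_2$ is the unique subset $K\subset I$ with $(w_0^{J_1}w_0^I)\ast(w_0^{J_2}w_0^I)=w_0^{K}w_0^I$ (such a $K$ always exists). $\bigsqcup$ denotes disjoint union. *)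

theory Defs
  imports
    "HOL-Algebra.QuotRing"
    "HOL-Algebra.Generated_Groups"
    "HOL-Algebra.Multiplicative_Group"
    "HOL-Library.Poly_Mapping"
    "HOL-Library.Disjoint_Sets"
begin

section \<open>Words\<close>

text \<open>The product \<open>f i\<^sub>1 \<otimes> \<dots> \<otimes> f i\<^sub>k\<close> in \<open>G\<close>, used for words in a Coxeter group
  and for words in the Hecke algebra.\<close>

definition word_prod :: "('a, 'b) monoid_scheme \<Rightarrow> ('i \<Rightarrow> 'a) \<Rightarrow> 'i list \<Rightarrow> 'a" where
  "word_prod G f u = foldr (\<lambda>i x. f i \<otimes>\<^bsub>G\<^esub> x) u \<one>\<^bsub>G\<^esub>"

text \<open>The alternating word \<open>i, j, i, \<dots>\<close> with \<open>n\<close> letters.\<close>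

primrec alt_word :: "'i \<Rightarrow> 'i \<Rightarrow> nat \<Rightarrow> 'i list" where
  "alt_word i j 0 = []"
| "alt_word i j (Suc n) = i # alt_word j i n"


section \<open>Coxeter groups\<close>

text \<open>The Coxeter matrix; the entry \<open>0\<close> stands for infinite order.\<close>

definition cox_mat :: "('w, 'b) monoid_scheme \<Rightarrow> ('i \<Rightarrow> 'w) \<Rightarrow> 'i \<Rightarrow> 'i \<Rightarrow> nat" where
  "cox_mat W s i j = group.ord W (s i \<otimes>\<^bsub>W\<^esub> s j)"

text \<open>The congruence on words over \<open>I\<close> generated by \<open>(s\<^sub>i s\<^sub>j)\<^bsup>m(i,j)\<^esup> = 1\<close>. For \<open>i = j\<close> and
  \<open>m(i,i) = 1\<close> this is \<open>s\<^sub>i\<^sup>2 = 1\<close>, so that the monoid presented in this way is the group with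
  that presentation; for \<open>m(i,j) = 0\<close> the relation is empty.\<close>

inductive cox_cong :: "('i \<Rightarrow> 'i \<Rightarrow> nat) \<Rightarrow> 'i set \<Rightarrow> 'i list \<Rightarrow> 'i list \<Rightarrow> bool"
  for m :: "'i \<Rightarrow> 'i \<Rightarrow> nat" and I :: "'i set"
where
  rel: "\<lbrakk>u \<in> lists I; v \<in> lists I; i \<in> I; j \<in> I\<rbrakk>
    \<Longrightarrow> cox_cong m I (u @ concat (replicate (m i j) [i, j]) @ v) (u @ v)"
| refl: "u \<in> lists I \<Longrightarrow> cox_cong m I u u"
| sym: "cox_cong m I u v \<Longrightarrow> cox_cong m I v u"
| trans: "\<lbrakk>cox_cong m I u v; cox_cong m I v w\<rbrakk> \<Longrightarrow> cox_cong m I u w"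

locale coxeter_group = group W
  for W :: "('w, 'b) monoid_scheme" (structure) +
  fixes I :: "'i set" and s :: "'i \<Rightarrow> 'w"
  assumes simple_closed: "i \<in> I \<Longrightarrow> s i \<in> carrier W"
    and simple_inj: "inj_on s I"
    and simple_not_one: "i \<in> I \<Longrightarrow> s i \<noteq> \<one>"
    and simple_square: "i \<in> I \<Longrightarrow> s i \<otimes> s i = \<one>"
    and simple_generate: "generate W (s ` I) = carrier W"
    and presentation: "\<lbrakk>u \<in> lists I; v \<in> lists I; word_prod W s u = word_prod W s v\<rbrakk>
      \<Longrightarrow> cox_cong (cox_mat W s) I u v"

definition cox_length :: "('w, 'b) monoid_scheme \<Rightarrow> 'i set \<Rightarrow> ('i \<Rightarrow> 'w) \<Rightarrow> 'w \<Rightarrow> nat" where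
  "cox_length W I s w = (LEAST n. \<exists>u \<in> lists I. word_prod W s u = w \<and> length u = n)"

definition reduced_word :: "('w, 'b) monoid_scheme \<Rightarrow> 'i set \<Rightarrow> ('i \<Rightarrow> 'w) \<Rightarrow> 'w \<Rightarrow> 'i list \<Rightarrow> bool" where
  "reduced_word W I s w u \<longleftrightarrow>
     u \<in> lists I \<and> word_prod W s u = w \<and> length u = cox_length W I s w"

definition parabolic :: "('w, 'b) monoid_scheme \<Rightarrow> ('i \<Rightarrow> 'w) \<Rightarrow> 'i set \<Rightarrow> 'w set" where
  "parabolic W s J = generate W (s ` J)"

definition longest :: "('w, 'b) monoid_scheme \<Rightarrow> 'i set \<Rightarrow> ('i \<Rightarrow> 'w) \<Rightarrow> 'i set \<Rightarrow> 'w" where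
  "longest W I s J = (THE w. w \<in> parabolic W s J \<and>
     (\<forall>v \<in> parabolic W s J. cox_length W I s v \<le> cox_length W I s w))"

text \<open>Edges of the Coxeter graph: \<open>m(i,j) \<ge> 3\<close>, including \<open>m(i,j) = \<infinity>\<close>.\<close>

definition cox_edge :: "('w, 'b) monoid_scheme \<Rightarrow> ('i \<Rightarrow> 'w) \<Rightarrow> 'i \<Rightarrow> 'i \<Rightarrow> bool" where
  "cox_edge W s i j \<longleftrightarrow> i \<noteq> j \<and> (3 \<le> cox_mat W s i j \<or> cox_mat W s i j = 0)"

text \<open>Connected components of the full subgraph on \<open>J\<close>.\<close>

definition cox_components :: "('w, 'b) monoid_scheme \<Rightarrow> ('i \<Rightarrow> 'w) \<Rightarrow> 'i set \<Rightarrow> 'i set set" where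
  "cox_components W s J = J // {(i, j). i \<in> J \<and> j \<in> J \<and> cox_edge W s i j}\<^sup>*"


section \<open>The 0-Hecke algebra\<close>

text \<open>The free monoid as a type of class \<open>monoid_add\<close>, written additively, so that
  \<open>'i fmon \<Rightarrow>\<^sub>0 int\<close> with the convolution product of \<open>Poly_Mapping\<close> is the free associative
  ring on \<open>'i\<close>.\<close>

datatype 'i fmon = FMon (letters: "'i list")

instantiation fmon :: (type) monoid_add
begin

definition zero_fmon :: "'a fmon" where
  "zero_fmon = FMon []"

definition plus_fmon :: "'a fmon \<Rightarrow> 'a fmon \<Rightarrow> 'a fmon" where
  "plus_fmon a b = FMon (letters a @ letters b)"

instance
  by standard (auto simp: zero_fmon_def plus_fmon_def)

end

definition free_alg :: "'i set \<Rightarrow> ('i fmon \<Rightarrow>\<^sub>0 int) ring" where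
  "free_alg I = \<lparr>carrier = {a. \<forall>w \<in> Poly_Mapping.keys a. letters w \<in> lists I},
     monoid.mult = (*), one = 1, zero = 0, add = (+)\<rparr>"

definition monomial :: "'i list \<Rightarrow> ('i fmon \<Rightarrow>\<^sub>0 int)" where
  "monomial u = Poly_Mapping.single (FMon u) 1"

text \<open>If \<open>m(i,j) = \<infinity>\<close>, encoded as \<open>0\<close>, the braid relation reads \<open>1 - 1\<close>, i.e. it is absent.\<close>

definition hecke_rels :: "('w, 'b) monoid_scheme \<Rightarrow> 'i set \<Rightarrow> ('i \<Rightarrow> 'w) \<Rightarrow> ('i fmon \<Rightarrow>\<^sub>0 int) set" where
  "hecke_rels W I s =
     {monomial [i, i] - monomial [i] | i. i \<in> I} \<union>
     {monomial (alt_word i j (cox_mat W s i j)) - monomial (alt_word j i (cox_mat W s i j))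
       | i j. i \<in> I \<and> j \<in> I \<and> i \<noteq> j}"

definition hecke_ideal :: "('w, 'b) monoid_scheme \<Rightarrow> 'i set \<Rightarrow> ('i \<Rightarrow> 'w) \<Rightarrow> ('i fmon \<Rightarrow>\<^sub>0 int) set" where
  "hecke_ideal W I s = Idl\<^bsub>free_alg I\<^esub> (hecke_rels W I s)"

definition hecke :: "('w, 'b) monoid_scheme \<Rightarrow> 'i set \<Rightarrow> ('i \<Rightarrow> 'w) \<Rightarrow> ('i fmon \<Rightarrow>\<^sub>0 int) set ring" where
  "hecke W I s = free_alg I Quot hecke_ideal W I s"

definition hecke_gen :: "('w, 'b) monoid_scheme \<Rightarrow> 'i set \<Rightarrow> ('i \<Rightarrow> 'w) \<Rightarrow> 'i \<Rightarrow> ('i fmon \<Rightarrow>\<^sub>0 int) set" where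
  "hecke_gen W I s i = hecke_ideal W I s +>\<^bsub>free_alg I\<^esub> monomial [i]"

text \<open>\<open>T'\<^sub>w\<close>; by Matsumoto's theorem the choice of the reduced word is immaterial.\<close>

definition hecke_basis :: "('w, 'b) monoid_scheme \<Rightarrow> 'i set \<Rightarrow> ('i \<Rightarrow> 'w) \<Rightarrow> 'w \<Rightarrow> ('i fmon \<Rightarrow>\<^sub>0 int) set" where
  "hecke_basis W I s w =
     word_prod (hecke W I s) (hecke_gen W I s) (SOME u. reduced_word W I s w u)"

definition demazure :: "('w, 'b) monoid_scheme \<Rightarrow> 'i set \<Rightarrow> ('i \<Rightarrow> 'w) \<Rightarrow> 'w \<Rightarrow> 'w \<Rightarrow> 'w" where
  "demazure W I s x y = (THE z. z \<in> carrier W \<and>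
     hecke_basis W I s x \<otimes>\<^bsub>hecke W I s\<^esub> hecke_basis W I s y = hecke_basis W I s z)"


section \<open>The operation on subsets of \<open>I\<close>\<close>

definition star :: "('w, 'b) monoid_scheme \<Rightarrow> 'i set \<Rightarrow> ('i \<Rightarrow> 'w) \<Rightarrow> 'i set \<Rightarrow> 'i set \<Rightarrow> 'i set" where
  "star W I s J\<^sub>1 J\<^sub>2 = (THE K. K \<subseteq> I \<and>
     demazure W I s (longest W I s J\<^sub>1 \<otimes>\<^bsub>W\<^esub> longest W I s I) (longest W I s J\<^sub>2 \<otimes>\<^bsub>W\<^esub> longest W I s I)
       = longest W I s K \<otimes>\<^bsub>W\<^esub> longest W I s I)"

end

theory Submission
  imports Defs
begin

text \<open>Write \<open>w\<^sub>J\<close> for the longest element of \<open>W\<^sub>J\<close>, \<open>w\<^sub>0 = w\<^sub>I\<close>, and \<open>x\<^sub>J = w\<^sub>J w\<^sub>0\<close>, so that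
\<open>K = A \<star> B\<close> means \<open>x\<^sub>A \<^bold>* x\<^sub>B = x\<^sub>K\<close>. The set \<open>J\<close> is recovered from \<open>x\<^sub>J\<close> as its set of left
ascents (\<open>left_ascents_max_rep\<close>), and everything takes place in the monoid \<open>(W, \<^bold>*)\<close>, without
the Bruhat order.

\<^bold>\<open>Existence of \<open>K\<close>.\<close> Call \<open>w\<close> flippable if every left ascent \<open>i\<close> of \<open>w\<close> satisfies
\<open>s\<^sub>i \<^bold>* w = w \<^bold>* s\<^sub>k\<close> for some \<open>k\<close>. Each \<open>x\<^sub>J\<close> is flippable, since conjugation by \<open>w\<^sub>J\<close> and then by
\<open>w\<^sub>0\<close> permutes simple reflections. Associativity alone shows that flippable elements form a
submonoid (\<open>flippable_dem\<close>). Conversely a flippable \<open>w\<close> with left ascents \<open>J\<close> is \<open>x\<^sub>J\<close>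
(\<open>flippable_imp_max_rep\<close>): moving letters of \<open>J\<close> from the left of \<open>w\<close> to its right shows
\<open>w\<^sub>J \<^bold>* w = w \<^bold>* b\<close>, and this element is fixed by every \<open>s\<^sub>i\<close>, for \<open>i \<in> J\<close> because of the left hand
expression and for \<open>i \<notin> J\<close> because of the right hand one. So it is \<open>w\<^sub>0\<close>, and \<open>w = w\<^sub>J w\<^sub>0\<close> follows.

\<^bold>\<open>Commutativity.\<close> The map \<open>x \<mapsto> w\<^sub>0 x\<^sup>-\<^sup>1 w\<^sub>0\<close> is an anti-automorphism of \<open>(W, \<^bold>*)\<close> that fixes every
\<open>x\<^sub>J\<close>; hence \<open>A \<star> B = B \<star> A\<close> (\<open>star_commute\<close>). As \<open>A \<star> B \<subseteq> A\<close> is immediate, also \<open>A \<star> B \<subseteq> B\<close>.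

\<^bold>\<open>Components.\<close> Let \<open>A \<subseteq> J\<close> be a union of components of \<open>J\<close>, and \<open>D = J - A\<close>. Then
\<open>w\<^sub>D \<^bold>* x\<^sub>K = x\<^bsub>K \<inter> A\<^esub>\<close> for all \<open>K \<subseteq> J\<close> (\<open>dem_lg_max_rep\<close>). With \<open>K = J\<close> this says
\<open>x\<^sub>A = w\<^sub>D \<^bold>* x\<^sub>J\<close>, and with \<open>K = J \<star> B\<close> it gives \<open>x\<^sub>A \<^bold>* x\<^sub>B = w\<^sub>D \<^bold>* x\<^sub>J \<^bold>* x\<^sub>B = x\<^bsub>K \<inter> A\<^esub>\<close>, that is,
\<open>A \<star> B = (J \<star> B) \<inter> A\<close> (\<open>star_restrict\<close>). By commutativity the same holds in the second argument,
so for components \<open>A\<close> of \<open>J\<^sub>1\<close> and \<open>B\<close> of \<open>J\<^sub>2\<close> the set \<open>A \<star> B\<close> is the part of \<open>J\<^sub>1 \<star> J\<^sub>2\<close> in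
\<open>A \<inter> B\<close>. These parts are disjoint, and they exhaust \<open>J\<^sub>1 \<star> J\<^sub>2 \<subseteq> J\<^sub>1 \<inter> J\<^sub>2\<close>.

\<^bold>\<open>Foundations.\<close> The presentation yields the exchange condition (\<open>exchange\<close>) through the parity
with which a reflection occurs along a word. Exchange makes the operators
\<open>w \<mapsto> max(w, s\<^sub>i w)\<close> and \<open>w \<mapsto> max(w, w s\<^sub>j)\<close> commute, which defines \<open>\<^bold>*\<close> and proves its
associativity and the braid relations. Matsumoto's theorem and the action of the \<open>0\<close>-Hecke
algebra by these operators identify \<open>\<^bold>*\<close> with the product of the elements \<open>T'\<^sub>w\<close>
(\<open>demazure_eq\<close>).\<close>

section \<open>Words, parabolic subgroups and length\<close>

context coxeter_group
begin

abbreviation wd :: "'i list \<Rightarrow> 'w" where "wd \<equiv> word_prod W s"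
abbreviation len :: "'w \<Rightarrow> nat" where "len \<equiv> cox_length W I s"
abbreviation red :: "'w \<Rightarrow> 'i list \<Rightarrow> bool" where "red \<equiv> reduced_word W I s"

declare simple_closed [simp]

text \<open>Words are handled as members of \<open>lists I\<close>; without this the classical rules would split
the membership into one condition per letter.\<close>

declare in_listsD [rule del] in_listsI [rule del]

lemma rev_lists [simp]: "rev u \<in> lists A \<longleftrightarrow> u \<in> lists A"
  by (simp add: in_lists_conv_set)

lemma simple_cancel [simp]: "i \<in> I \<Longrightarrow> x \<in> carrier W \<Longrightarrow> s i \<otimes> (s i \<otimes> x) = x"
  by (simp add: m_assoc [symmetric] simple_square)

lemma simple_cancel_right [simp]: "i \<in> I \<Longrightarrow> x \<in> carrier W \<Longrightarrow> x \<otimes> s i \<otimes> s i = x"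
  by (simp add: m_assoc simple_square)

lemma inv_simple [simp]: "i \<in> I \<Longrightarrow> inv (s i) = s i"
  by (simp add: inv_equality simple_square)

lemma wd_Nil [simp]: "wd [] = \<one>"
  by (simp add: word_prod_def)

lemma wd_Cons [simp]: "wd (i # u) = s i \<otimes> wd u"
  by (simp add: word_prod_def)

lemma wd_closed [simp]: "u \<in> lists I \<Longrightarrow> wd u \<in> carrier W"
  by (induction u) auto

lemma wd_append: "u \<in> lists I \<Longrightarrow> v \<in> lists I \<Longrightarrow> wd (u @ v) = wd u \<otimes> wd v"
  by (induction u) (auto simp: m_assoc)

lemma wd_rev: "u \<in> lists I \<Longrightarrow> wd (rev u) = inv (wd u)"
  by (induction u) (auto simp: wd_append inv_mult_group)

lemma parabolic_Nil: "\<one> \<in> parabolic W s J"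
  by (simp add: parabolic_def generate.one)

lemma parabolic_mult: "x \<in> parabolic W s J \<Longrightarrow> y \<in> parabolic W s J \<Longrightarrow> x \<otimes> y \<in> parabolic W s J"
  by (simp add: parabolic_def generate.eng)

lemma parabolic_simple: "j \<in> J \<Longrightarrow> s j \<in> parabolic W s J"
  by (simp add: parabolic_def generate.incl)

lemma parabolic_wd: "u \<in> lists J \<Longrightarrow> wd u \<in> parabolic W s J"
  by (induction u) (auto intro: parabolic_Nil parabolic_mult parabolic_simple)

lemma parabolic_word:
  assumes "J \<subseteq> I" "x \<in> parabolic W s J"
  shows "\<exists>u \<in> lists J. wd u = x"
  using assms(2) unfolding parabolic_def
proof (induction rule: generate.induct)
  case one
  show ?case by (rule bexI [of _ "[]"]) auto
next
  case (incl h)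
  then obtain j where "j \<in> J" "h = s j" by auto
  then show ?case using assms(1) by (intro bexI [of _ "[j]"]) auto
next
  case (inv h)
  then obtain j where "j \<in> J" "h = s j" by auto
  then show ?case using assms(1) by (intro bexI [of _ "[j]"]) auto
next
  case (eng h1 h2)
  then obtain u v where "u \<in> lists J" "v \<in> lists J" "wd u = h1" "wd v = h2" by auto
  moreover have "lists J \<subseteq> lists I" using assms(1) by (rule lists_mono)
  ultimately show ?case using wd_append [of u v] by (intro bexI [of _ "u @ v"]) auto
qed

lemma parabolic_all: "parabolic W s I = carrier W"
  by (simp add: parabolic_def simple_generate)

lemma parabolic_closed: "J \<subseteq> I \<Longrightarrow> x \<in> parabolic W s J \<Longrightarrow> x \<in> carrier W"
  using parabolic_word [of J x] wd_closed lists_mono [of J I] by blast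

lemma parabolic_inv:
  assumes "J \<subseteq> I" "x \<in> parabolic W s J"
  shows "inv x \<in> parabolic W s J"
proof -
  obtain u where "u \<in> lists J" "wd u = x" using parabolic_word [OF assms] by blast
  moreover have "u \<in> lists I" using lists_mono [OF assms(1)] \<open>u \<in> lists J\<close> by blast
  ultimately show ?thesis using parabolic_wd [of "rev u" J] by (simp add: wd_rev)
qed

lemma ex_word: "w \<in> carrier W \<Longrightarrow> \<exists>u \<in> lists I. wd u = w"
  using parabolic_word [of I w] by (simp add: parabolic_all)

lemma len_le: "u \<in> lists I \<Longrightarrow> len (wd u) \<le> length u"
  unfolding cox_length_def by (rule Least_le) auto

lemma ex_red: "w \<in> carrier W \<Longrightarrow> \<exists>u. red w u"
  unfolding cox_length_def reduced_word_def
  by (rule LeastI2_ex [where Q = "\<lambda>n. \<exists>u. u \<in> lists I \<and> wd u = w \<and> length u = n"])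
     (use ex_word [of w] in auto)

lemma redD: "red w u \<Longrightarrow> u \<in> lists I" "red w u \<Longrightarrow> wd u = w" "red w u \<Longrightarrow> length u = len w"
    "red w u \<Longrightarrow> w \<in> carrier W"
  by (auto simp: reduced_word_def)

lemma red_iff: "red w u \<longleftrightarrow> u \<in> lists I \<and> wd u = w \<and> length u \<le> len w"
  using len_le [of u] by (auto simp: reduced_word_def)

lemma len_one [simp]: "len \<one> = 0"
  using len_le [of "[]"] by simp

lemma len_mult: "x \<in> carrier W \<Longrightarrow> y \<in> carrier W \<Longrightarrow> len (x \<otimes> y) \<le> len x + len y"
proof -
  assume "x \<in> carrier W" "y \<in> carrier W"
  then obtain u v where "red x u" "red y v" using ex_red by blast
  then show ?thesis using len_le [of "u @ v"] by (auto simp: reduced_word_def wd_append)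
qed

lemma len_inv_le: "w \<in> carrier W \<Longrightarrow> len (inv w) \<le> len w"
proof -
  assume "w \<in> carrier W"
  then obtain u where u: "red w u" using ex_red by blast
  then show ?thesis using len_le [of "rev u"] wd_rev [of u] by (auto simp: reduced_word_def)
qed

lemma len_inv [simp]: "w \<in> carrier W \<Longrightarrow> len (inv w) = len w"
  using len_inv_le [of w] len_inv_le [of "inv w"] by simp

section \<open>The exchange condition\<close>

text \<open>Along a word \<open>i\<^sub>1 \<dots> i\<^sub>k\<close> the reflections \<open>s\<^bsub>i\<^sub>1\<^esub> \<dots> s\<^bsub>i\<^sub>p\<^esub> \<dots> s\<^bsub>i\<^sub>1\<^esub>\<close>, \<open>1 \<le> p \<le> k\<close>, are the ones that can be
multiplied onto the word from the left by deleting a letter. Whether \<open>t\<close> occurs an odd number of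
times among them depends only on the element that the word represents; the reflections with odd
count are the left inversions of that element.\<close>

primrec refl_parity :: "'i list \<Rightarrow> 'w \<Rightarrow> bool" where
  "refl_parity [] t = False"
| "refl_parity (i # u) t = ((t = s i) \<noteq> refl_parity u (s i \<otimes> t \<otimes> s i))"

lemma refl_parity_append:
  "u \<in> lists I \<Longrightarrow> v \<in> lists I \<Longrightarrow> t \<in> carrier W \<Longrightarrow>
    refl_parity (u @ v) t = (refl_parity u t \<noteq> refl_parity v (inv (wd u) \<otimes> t \<otimes> wd u))"
  by (induction u arbitrary: t) (auto simp: inv_mult_group m_assoc)

lemma conj_simple_eq:
  assumes "i \<in> I" "t \<in> carrier W" "x \<in> carrier W"
  shows "s i \<otimes> t \<otimes> s i = x \<longleftrightarrow> t = s i \<otimes> x \<otimes> s i"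
  using assms by (metis m_assoc m_closed simple_cancel simple_cancel_right simple_closed)

lemma pow_swap:
  assumes "i \<in> I" "j \<in> I"
  shows "s i \<otimes> ((s j \<otimes> s i) [^] (p::nat) \<otimes> s j) \<otimes> s i = (s i \<otimes> s j) [^] Suc p \<otimes> s i"
  using assms
proof (induction p)
  case (Suc p)
  have "s i \<otimes> ((s j \<otimes> s i) [^] Suc p \<otimes> s j) \<otimes> s i
      = s i \<otimes> ((s j \<otimes> s i) [^] p \<otimes> s j) \<otimes> s i \<otimes> s j \<otimes> s i"
    using Suc.prems by (simp add: m_assoc)
  then show ?case unfolding Suc.IH [OF Suc.prems] using Suc.prems by (simp add: m_assoc)
qed (simp add: m_assoc)

text \<open>The \<open>p\<close>-th reflection along \<open>i, j, i, \<dots>\<close> is \<open>(s\<^sub>i s\<^sub>j)\<^sup>p s\<^sub>i\<close>, counting from \<open>p = 0\<close>.\<close>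

lemma refl_parity_alt:
  "i \<in> I \<Longrightarrow> j \<in> I \<Longrightarrow> t \<in> carrier W \<Longrightarrow>
    refl_parity (alt_word i j n) t = odd (card {p. p < n \<and> t = (s i \<otimes> s j) [^] p \<otimes> s i})"
proof (induction n arbitrary: i j t)
  case (Suc n)
  let ?A = "{p. p < n \<and> s i \<otimes> t \<otimes> s i = (s j \<otimes> s i) [^] p \<otimes> s j}"
  let ?B = "{p. p < Suc n \<and> t = (s i \<otimes> s j) [^] p \<otimes> s i}"
  have A: "?A = {p. p < n \<and> t = (s i \<otimes> s j) [^] Suc p \<otimes> s i}"
    using Suc.prems conj_simple_eq [of i t] pow_swap [of i j] by auto
  have B: "?B = (if t = s i then insert 0 (Suc ` ?A) else Suc ` ?A)"
  proof (rule Set.set_eqI)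
    fix p show "p \<in> ?B \<longleftrightarrow> p \<in> (if t = s i then insert 0 (Suc ` ?A) else Suc ` ?A)"
      unfolding A using Suc.prems by (cases p) auto
  qed
  have "card (Suc ` ?A) = card ?A" by (rule card_image) simp
  moreover have "finite ?A" by simp
  ultimately have "odd (card ?B) = ((t = s i) \<noteq> odd (card ?A))"
    unfolding B by auto
  then show ?case using Suc by simp
qed simp

lemma alt_lists: "i \<in> A \<Longrightarrow> j \<in> A \<Longrightarrow> alt_word i j n \<in> lists A"
  by (induction n arbitrary: i j) auto

lemma length_alt [simp]: "length (alt_word i j n) = n"
  by (induction n arbitrary: i j) auto

lemma concat_alt: "concat (replicate n [i, j]) = alt_word i j (2 * n)"
  by (induction n) auto

lemma wd_alt_even: "i \<in> I \<Longrightarrow> j \<in> I \<Longrightarrow> wd (alt_word i j (2 * n)) = (s i \<otimes> s j) [^] n"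
proof (induction n)
  case (Suc n)
  then show ?case using nat_pow_mult [of "s i \<otimes> s j" 1 n] by (simp add: m_assoc)
qed simp

lemma wd_rel: "i \<in> I \<Longrightarrow> j \<in> I \<Longrightarrow> wd (alt_word i j (2 * cox_mat W s i j)) = \<one>"
  by (simp add: wd_alt_even cox_mat_def)

text \<open>The sequence of \<open>2m\<close> reflections along \<open>(s\<^sub>i s\<^sub>j)\<^sup>m\<close> has period \<open>m\<close>, so each reflection occurs an
even number of times. This is where the relators of the presentation enter.\<close>

lemma refl_parity_relator:
  assumes "i \<in> I" "j \<in> I" "t \<in> carrier W"
  shows "\<not> refl_parity (alt_word i j (2 * cox_mat W s i j)) t"
proof -
  let ?m = "cox_mat W s i j" and ?c = "s i \<otimes> s j"
  define A where "A = {p. p < ?m \<and> t = ?c [^] p \<otimes> s i}"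
  have c: "?c \<in> carrier W" using assms by simp
  have one: "?c [^] ?m = \<one>" using c by (simp add: cox_mat_def)
  have per: "?c [^] (?m + p) = ?c [^] p" for p
    using c one by (simp add: nat_pow_mult [symmetric])
  have "{p. p < 2 * ?m \<and> t = ?c [^] p \<otimes> s i} = A \<union> (\<lambda>p. ?m + p) ` A" (is "?S = _")
  proof (intro equalityI subsetI)
    fix p assume p: "p \<in> ?S"
    show "p \<in> A \<union> (\<lambda>p. ?m + p) ` A"
    proof (cases "p < ?m")
      case True then show ?thesis using p by (simp add: A_def)
    next
      case False
      then have "p - ?m \<in> A" using p per [of "p - ?m"] by (auto simp: A_def)
      then show ?thesis using False by (intro UnI2 image_eqI [of _ _ "p - ?m"]) auto
    qed
  qed (auto simp: A_def per)
  moreover have "card (A \<union> (\<lambda>p. ?m + p) ` A) = card A + card A"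
  proof -
    have "finite A" by (simp add: A_def)
    then show ?thesis
      by (subst card_Un_disjoint) (auto simp: A_def card_image)
  qed
  ultimately show ?thesis using assms by (simp add: refl_parity_alt)
qed

lemma refl_parity_cong:
  assumes "cox_cong (cox_mat W s) I u v"
  shows "u \<in> lists I \<and> v \<in> lists I \<and> (\<forall>t \<in> carrier W. refl_parity u t = refl_parity v t)"
  using assms
proof induction
  case (rel u v i j)
  let ?r = "alt_word i j (2 * cox_mat W s i j)"
  have r: "?r \<in> lists I" using rel alt_lists by metis
  have "refl_parity (u @ ?r @ v) t = refl_parity (u @ v) t" if t: "t \<in> carrier W" for t
    using rel r t by (simp add: refl_parity_append refl_parity_relator wd_rel)
  moreover have "u @ ?r @ v \<in> lists I" "u @ v \<in> lists I" using rel r by auto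
  ultimately show ?case unfolding concat_alt by blast
qed auto

lemma refl_parity_eq:
  "u \<in> lists I \<Longrightarrow> v \<in> lists I \<Longrightarrow> wd u = wd v \<Longrightarrow> t \<in> carrier W \<Longrightarrow> refl_parity u t = refl_parity v t"
  using refl_parity_cong [OF presentation] by blast

lemma refl_parity_delete:
  "u \<in> lists I \<Longrightarrow> t \<in> carrier W \<Longrightarrow> refl_parity u t \<Longrightarrow>
    \<exists>p k q. u = p @ k # q \<and> t \<otimes> wd u = wd (p @ q)"
proof (induction u arbitrary: t)
  case (Cons k u)
  show ?case
  proof (cases "t = s k")
    case True
    then show ?thesis using Cons.prems by (intro exI [of _ "[]"]) auto
  next
    case False
    then have "refl_parity u (s k \<otimes> t \<otimes> s k)" using Cons.prems by simp
    then obtain p l q where *: "u = p @ l # q" "s k \<otimes> t \<otimes> s k \<otimes> wd u = wd (p @ q)"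
      using Cons.IH [of "s k \<otimes> t \<otimes> s k"] Cons.prems by auto
    have "t \<otimes> wd (k # u) = s k \<otimes> (s k \<otimes> t \<otimes> s k \<otimes> wd u)"
      using Cons.prems by (simp add: m_assoc)
    then have "t \<otimes> wd (k # u) = wd ((k # p) @ q)" unfolding *(2) by simp
    then show ?thesis using * by (intro exI [of _ "k # p"]) auto
  qed
qed simp

text \<open>The number of inversions bounds the length of every word from below; this is used to see that
short alternating words are reduced.\<close>

lemma refl_parity_card: "u \<in> lists I \<Longrightarrow> finite {t \<in> carrier W. refl_parity u t} \<and> card {t \<in> carrier W. refl_parity u t} \<le> length u"
proof (induction u)
  case (Cons i u)
  let ?A = "{t \<in> carrier W. refl_parity u t}" and ?f = "\<lambda>t. s i \<otimes> t \<otimes> s i"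
  have i: "i \<in> I" using Cons by simp
  have sub: "{t \<in> carrier W. refl_parity (i # u) t} \<subseteq> insert (s i) (?f ` ?A)"
  proof
    fix t assume t: "t \<in> {t \<in> carrier W. refl_parity (i # u) t}"
    have "t = s i \<otimes> (s i \<otimes> t \<otimes> s i) \<otimes> s i"
      using t i by (simp add: m_assoc simple_square)
    then show "t \<in> insert (s i) (?f ` ?A)" using t i by auto
  qed
  have fin: "finite ?A" "card ?A \<le> length u" using Cons by auto
  have fin': "finite (insert (s i) (?f ` ?A))" using fin(1) by simp
  have "card {t \<in> carrier W. refl_parity (i # u) t} \<le> card (insert (s i) (?f ` ?A))"
    by (rule card_mono [OF fin' sub])
  also have "\<dots> \<le> Suc (card (?f ` ?A))"
    by (rule card_insert_le_m1) auto
  also have "\<dots> \<le> Suc (length u)"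
    using card_image_le [OF fin(1), of ?f] fin(2) by (simp only: Suc_le_mono)
  finally have "card {t \<in> carrier W. refl_parity (i # u) t} \<le> length (i # u)" by (simp only: length_Cons)
  then show ?case using finite_subset [OF sub fin'] by blast
qed simp

lemma refl_parity_descent:
  assumes "i \<in> I" "u \<in> lists I" "refl_parity u (s i)"
  shows "len (s i \<otimes> wd u) < len (wd u)"
proof -
  obtain v where v: "red (wd u) v" using ex_red [OF wd_closed [OF assms(2)]] by blast
  then have "refl_parity v (s i)"
    using refl_parity_eq [OF assms(2) redD(1) [OF v] redD(2) [OF v, symmetric], of "s i"] assms by simp
  then obtain p k q where *: "v = p @ k # q" "s i \<otimes> wd v = wd (p @ q)"
    using refl_parity_delete [of v "s i"] redD(1) [OF v] assms by auto
  then have "len (s i \<otimes> wd u) \<le> length (p @ q)"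
    using len_le [of "p @ q"] redD(1,2) [OF v] by simp
  also have "\<dots> < len (wd u)" using redD(3) [OF v] *(1) by simp
  finally show ?thesis .
qed

text \<open>If \<open>s\<^sub>i\<close> is not an inversion of \<open>w\<close>, then it is one of \<open>s\<^sub>i w\<close>, and the descent criterion applies
to \<open>s\<^sub>i w\<close>.\<close>

lemma refl_parity_ascent:
  assumes "i \<in> I" "u \<in> lists I" "\<not> refl_parity u (s i)"
  shows "len (wd u) < len (s i \<otimes> wd u)"
  using refl_parity_descent [of i "i # u"] assms by (simp add: m_assoc simple_square)

lemma len_simple_cases:
  assumes "i \<in> I" "w \<in> carrier W"
  obtains "len (s i \<otimes> w) = Suc (len w)" | "len w = Suc (len (s i \<otimes> w))"
proof -
  obtain u where u: "red w u" using ex_red assms by blast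
  have si: "len (s i) \<le> 1" using len_le [of "[i]"] assms by simp
  have "len (s i \<otimes> w) \<le> Suc (len w)" "len w \<le> Suc (len (s i \<otimes> w))"
    using len_mult [of "s i" w] len_mult [of "s i" "s i \<otimes> w"] assms si by auto
  moreover have "len (s i \<otimes> w) < len w \<or> len w < len (s i \<otimes> w)"
    using refl_parity_descent [of i u] refl_parity_ascent [of i u] redD(1,2) [OF u] assms by blast
  ultimately show ?thesis using that by linarith
qed

lemma exchange:
  assumes "i \<in> I" "u \<in> lists I" "len (s i \<otimes> wd u) < len (wd u)"
  shows "\<exists>p k q. u = p @ k # q \<and> s i \<otimes> wd u = wd (p @ q)"
  using refl_parity_delete [of u "s i"] refl_parity_ascent [of i u] assms by fastforce

lemma len_simple: "i \<in> I \<Longrightarrow> len (s i) = 1"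
  using len_simple_cases [of i \<one>] by auto

lemma len_right_cases:
  assumes "i \<in> I" "w \<in> carrier W"
  obtains "len (w \<otimes> s i) = Suc (len w)" | "len w = Suc (len (w \<otimes> s i))"
  using len_simple_cases [of i "inv w"] assms len_inv [of "w \<otimes> s i"]
  by (auto simp: inv_mult_group)

lemma len_1:
  assumes "w \<in> carrier W" "len w = 1"
  shows "\<exists>i \<in> I. w = s i"
proof -
  obtain u where u: "red w u" using ex_red assms by blast
  then obtain i where "u = [i]" using redD(3) [OF u] assms(2) by (auto simp: length_Suc_conv)
  then show ?thesis using redD(1,2) [OF u] by auto
qed

lemma red_Cons: "red w (i # u) \<Longrightarrow> red (wd u) u \<and> len w = Suc (len (wd u)) \<and> w = s i \<otimes> wd u"
  using len_mult [of "s i" "wd u"] len_le [of u] len_simple [of i] by (auto simp: reduced_word_def)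

lemma red_rev: "red w u \<Longrightarrow> red (inv w) (rev u)"
  by (auto simp: reduced_word_def wd_rev)

lemma red_wd: "red w u \<Longrightarrow> v \<in> lists I \<Longrightarrow> wd v = w \<Longrightarrow> length v = length u \<Longrightarrow> red w v"
  by (simp add: reduced_word_def)

text \<open>The first \<open>m(i,j)\<close> reflections \<open>(s\<^sub>i s\<^sub>j)\<^sup>p s\<^sub>i\<close> are distinct, so all of them are inversions.\<close>

lemma red_alt:
  assumes "i \<in> I" "j \<in> I" "n \<le> cox_mat W s i j"
  shows "red (wd (alt_word i j n)) (alt_word i j n)"
proof -
  let ?c = "s i \<otimes> s j" and ?u = "alt_word i j n"
  have c: "?c \<in> carrier W" using assms by simp
  have inj: "inj_on (\<lambda>p. ?c [^] p \<otimes> s i) {..<n}"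
  proof (rule inj_onI)
    fix p q assume *: "p \<in> {..<n}" "q \<in> {..<n}" "?c [^] p \<otimes> s i = ?c [^] q \<otimes> s i"
    then have "?c [^] p = ?c [^] q" using assms c by simp
    moreover have "inj_on (\<lambda>x. ?c [^] x) {0 .. ord ?c - 1}" using ord_inj [OF c] .
    ultimately show "p = q" using * assms by (auto simp: inj_on_def cox_mat_def)
  qed
  have u: "?u \<in> lists I" using assms alt_lists by metis
  obtain v where v: "red (wd ?u) v" using ex_red [OF wd_closed [OF u]] by blast
  have "(\<lambda>p. ?c [^] p \<otimes> s i) ` {..<n} \<subseteq> {t \<in> carrier W. refl_parity v t}"
  proof (rule image_subsetI)
    fix p assume p: "p \<in> {..<n}"
    then have "{q. q < n \<and> ?c [^] p \<otimes> s i = ?c [^] q \<otimes> s i} = {p}"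
      using inj by (auto simp: inj_on_def)
    then have "refl_parity ?u (?c [^] p \<otimes> s i)" using assms c by (simp add: refl_parity_alt)
    then show "?c [^] p \<otimes> s i \<in> {t \<in> carrier W. refl_parity v t}"
      using refl_parity_eq [OF u redD(1) [OF v] redD(2) [OF v, symmetric], of "?c [^] p \<otimes> s i"] assms c by simp
  qed
  from card_mono [OF _ this] have "n \<le> length v"
    using refl_parity_card [OF redD(1) [OF v]] card_image [OF inj] by simp
  then show ?thesis using red_iff u redD(3) [OF v] by simp
qed

section \<open>The Demazure product\<close>

text \<open>Elements outside the carrier are fixed, so that the relations between these operators hold as
equations of functions on the whole type.\<close>

definition ldem :: "'i \<Rightarrow> 'w \<Rightarrow> 'w" where
  "ldem i w = (if w \<in> carrier W \<and> len w < len (s i \<otimes> w) then s i \<otimes> w else w)"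

definition rdem :: "'i \<Rightarrow> 'w \<Rightarrow> 'w" where
  "rdem i w = (if len w < len (w \<otimes> s i) then w \<otimes> s i else w)"

lemma ldem_closed [simp]: "i \<in> I \<Longrightarrow> w \<in> carrier W \<Longrightarrow> ldem i w \<in> carrier W"
  by (simp add: ldem_def)

lemma rdem_closed [simp]: "i \<in> I \<Longrightarrow> w \<in> carrier W \<Longrightarrow> rdem i w \<in> carrier W"
  by (simp add: rdem_def)

lemma inv_ldem: "i \<in> I \<Longrightarrow> w \<in> carrier W \<Longrightarrow> inv (ldem i w) = rdem i (inv w)"
  using len_inv [of "s i \<otimes> w"] by (auto simp: ldem_def rdem_def inv_mult_group)

lemma ldem_eq_iff: "i \<in> I \<Longrightarrow> w \<in> carrier W \<Longrightarrow> ldem i w = w \<longleftrightarrow> len (s i \<otimes> w) < len w"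
  by (rule len_simple_cases [of i w]) (auto simp: ldem_def)

lemma ldem_up: "i \<in> I \<Longrightarrow> w \<in> carrier W \<Longrightarrow> ldem i w \<noteq> w \<Longrightarrow> ldem i w = s i \<otimes> w"
  by (auto simp: ldem_def)

lemma ldem_cases:
  assumes "i \<in> I" "w \<in> carrier W"
  obtains "len (s i \<otimes> w) = Suc (len w)" "ldem i w = s i \<otimes> w"
    | "len w = Suc (len (s i \<otimes> w))" "ldem i w = w"
proof -
  have "len (s i \<otimes> w) = Suc (len w) \<or> len w = Suc (len (s i \<otimes> w))"
    by (rule len_simple_cases [OF assms]) simp_all
  then show ?thesis
  proof
    assume *: "len (s i \<otimes> w) = Suc (len w)"
    then have "ldem i w = s i \<otimes> w" using assms by (simp add: ldem_def)
    with * show ?thesis by (rule that(1))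
  next
    assume *: "len w = Suc (len (s i \<otimes> w))"
    then have "\<not> len w < len (s i \<otimes> w)" by simp
    then have "ldem i w = w" by (simp add: ldem_def)
    with * show ?thesis by (rule that(2))
  qed
qed

lemma rdem_cases:
  assumes "i \<in> I" "w \<in> carrier W"
  obtains "len (w \<otimes> s i) = Suc (len w)" "rdem i w = w \<otimes> s i"
    | "len w = Suc (len (w \<otimes> s i))" "rdem i w = w"
proof -
  have "len (w \<otimes> s i) = Suc (len w) \<or> len w = Suc (len (w \<otimes> s i))"
    by (rule len_right_cases [OF assms]) simp_all
  then show ?thesis
  proof
    assume *: "len (w \<otimes> s i) = Suc (len w)"
    then have "rdem i w = w \<otimes> s i" using assms by (simp add: rdem_def)
    with * show ?thesis by (rule that(1))
  next
    assume *: "len w = Suc (len (w \<otimes> s i))"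
    then have "\<not> len w < len (w \<otimes> s i)" by simp
    then have "rdem i w = w" by (simp add: rdem_def)
    with * show ?thesis by (rule that(2))
  qed
qed

lemma ldem_idem: "i \<in> I \<Longrightarrow> ldem i (ldem i w) = ldem i w"
  by (auto simp: ldem_def)

text \<open>The only way in which a left and a right ascent of \<open>w\<close> can interfere: if \<open>s\<^sub>i w s\<^sub>j\<close> is not longer
than \<open>w\<close>, then exchanging \<open>s\<^sub>i\<close> into a reduced word of \<open>w s\<^sub>j\<close> must remove the last letter.\<close>

lemma simple_commute_if_len:
  assumes "i \<in> I" "j \<in> I" "w \<in> carrier W" "len (s i \<otimes> w) = Suc (len w)"
    "len (w \<otimes> s j) = Suc (len w)" "len (s i \<otimes> w \<otimes> s j) \<le> len w"
  shows "s i \<otimes> w = w \<otimes> s j"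
proof -
  obtain u where u: "red w u" using ex_red assms by blast
  have uI: "u \<in> lists I" and uw: "wd u = w" and ul: "length u = len w"
    using redD [OF u] by auto
  have w': "wd (u @ [j]) = w \<otimes> s j" using assms uI uw by (simp add: wd_append)
  have "len (s i \<otimes> wd (u @ [j])) < len (wd (u @ [j]))"
    unfolding w' using assms by (simp add: m_assoc)
  then obtain p k q where pq: "u @ [j] = p @ k # q" "s i \<otimes> wd (u @ [j]) = wd (p @ q)"
    using exchange [of i "u @ [j]"] assms uI by auto
  show ?thesis
  proof (cases q rule: rev_cases)
    case Nil
    then have "s i \<otimes> w \<otimes> s j = w" using pq assms w' uw by (simp add: m_assoc)
    then have "s i \<otimes> w \<otimes> s j \<otimes> s j = w \<otimes> s j" by simp
    then show ?thesis using assms by (simp del: r_cancel_one)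
  next
    case (snoc q' l)
    then have l: "l = j" and u': "u = p @ k # q'" using pq(1) by auto
    have pI: "p @ q' \<in> lists I" using uI u' by simp
    have "s i \<otimes> w \<otimes> s j = wd (p @ q') \<otimes> s j"
      using pq(2) assms uI pI unfolding w' snoc l
      by (simp add: m_assoc wd_append flip: append_assoc)
    then have "s i \<otimes> w = wd (p @ q')" using assms pI by simp
    then have "len (s i \<otimes> w) \<le> length (p @ q')" using len_le [OF pI] by simp
    then show ?thesis using assms(4) ul u' by simp
  qed
qed

text \<open>This commutation replaces the Bruhat order: it is the source of associativity and of the braid
relations, because the left and the right operators both produce every element from \<open>1\<close>.\<close>

lemma ldem_rdem:
  assumes "i \<in> I" "j \<in> I" "w \<in> carrier W"
  shows "ldem i (rdem j w) = rdem j (ldem i w)"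
proof -
  have a: "s i \<otimes> w \<in> carrier W" "w \<otimes> s j \<in> carrier W" "s i \<otimes> (w \<otimes> s j) = s i \<otimes> w \<otimes> s j"
    using assms by (auto simp: m_assoc)
  show ?thesis
  proof (rule ldem_cases [OF assms(1,3)]; rule rdem_cases [OF assms(2,3)])
    assume up: "len (s i \<otimes> w) = Suc (len w)" "ldem i w = s i \<otimes> w"
      "len (w \<otimes> s j) = Suc (len w)" "rdem j w = w \<otimes> s j"
    show ?thesis
    proof (cases "len (s i \<otimes> w \<otimes> s j) \<le> len w")
      case True
      then have "s i \<otimes> w = w \<otimes> s j" using simple_commute_if_len assms up by blast
      then show ?thesis using True up a by (simp add: ldem_def rdem_def)
    next
      case False
      have "len (s i \<otimes> w \<otimes> s j) \<noteq> Suc (len w)"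
        using len_simple_cases [OF assms(1) a(2)] a(3) up by (metis n_not_Suc_n)
      then show ?thesis using False up a by (simp add: ldem_def rdem_def)
    qed
  next
    assume *: "len (s i \<otimes> w) = Suc (len w)" "ldem i w = s i \<otimes> w"
      "len w = Suc (len (w \<otimes> s j))" "rdem j w = w"
    have "len (s i \<otimes> w \<otimes> s j) \<le> Suc (len (w \<otimes> s j))"
      using len_mult [of "s i" "w \<otimes> s j"] a assms len_simple by simp
    then show ?thesis using * by (simp add: rdem_def)
  next
    assume *: "len w = Suc (len (s i \<otimes> w))" "ldem i w = w"
      "len (w \<otimes> s j) = Suc (len w)" "rdem j w = w \<otimes> s j"
    have "len (s i \<otimes> w \<otimes> s j) \<le> Suc (len (s i \<otimes> w))"
      using len_mult [of "s i \<otimes> w" "s j"] a assms len_simple by simp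
    then show ?thesis using * a by (simp add: ldem_def)
  qed auto
qed

abbreviation ldems :: "'i list \<Rightarrow> 'w \<Rightarrow> 'w" where "ldems \<equiv> foldr ldem"
abbreviation rdems :: "'i list \<Rightarrow> 'w \<Rightarrow> 'w" where "rdems \<equiv> fold rdem"

lemma ldems_closed [simp]: "u \<in> lists I \<Longrightarrow> w \<in> carrier W \<Longrightarrow> ldems u w \<in> carrier W"
  by (induction u) auto

lemma rdems_closed [simp]: "u \<in> lists I \<Longrightarrow> w \<in> carrier W \<Longrightarrow> rdems u w \<in> carrier W"
  by (induction u arbitrary: w) auto

lemma ldems_rdems:
  assumes "u \<in> lists I" "v \<in> lists I" "w \<in> carrier W"
  shows "ldems u (rdems v w) = rdems v (ldems u w)"
proof -
  have one: "ldem i (rdems v w) = rdems v (ldem i w)" if "i \<in> I" "w \<in> carrier W" for i w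
    using assms(2) that by (induction v arbitrary: w) (auto simp: ldem_rdem)
  show ?thesis using assms(1,3)
    by (induction u) (auto simp: one assms(2))
qed

lemma ldems_red: "red w u \<Longrightarrow> ldems u \<one> = w"
proof (induction u arbitrary: w)
  case (Cons i u)
  from red_Cons [OF Cons.prems] have
    *: "red (wd u) u" "len w = Suc (len (wd u))" "w = s i \<otimes> wd u" by auto
  then show ?case using Cons.IH [OF *(1)] redD(4) [OF *(1)] by (simp add: ldem_def)
qed (simp add: reduced_word_def)

lemma inv_ldems: "u \<in> lists I \<Longrightarrow> w \<in> carrier W \<Longrightarrow> inv (ldems u w) = rdems (rev u) (inv w)"
  by (induction u) (auto simp: inv_ldem)

lemma rdems_red:
  assumes "red w u" shows "rdems u \<one> = w"
proof -
  have "ldems (rev u) \<one> = inv w" using ldems_red red_rev assms by blast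
  then have "inv (inv w) = rdems u \<one>"
    using inv_ldems [of "rev u" \<one>] redD(1) [OF assms] by simp
  then show ?thesis using redD(4) [OF assms] by simp
qed

text \<open>By \<open>dem_ldems_rdems\<close> the choice of the reduced word is immaterial: the value is also obtained by
letting a reduced word of \<open>y\<close> act on \<open>x\<close> from the right.\<close>

definition dem :: "'w \<Rightarrow> 'w \<Rightarrow> 'w" where
  "dem x y = ldems (SOME u. red x u) y"

lemma dem_ldems_rdems:
  assumes "red x u" "red y v"
  shows "dem x y = rdems v x" "dem x y = ldems u y"
proof -
  have *: "ldems u y = rdems v x" if "red x u" for u
    using ldems_rdems [of u v \<one>] rdems_red [OF assms(2)] ldems_red [OF that]
      redD(1) [OF that] redD(1) [OF assms(2)] by simp
  have "red x (SOME u. red x u)" using assms(1) by (rule someI)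
  from * [OF this] show "dem x y = rdems v x" by (simp add: dem_def)
  then show "dem x y = ldems u y" using * [OF assms(1)] by simp
qed

lemma dem_closed [simp]:
  assumes "x \<in> carrier W" "y \<in> carrier W" shows "dem x y \<in> carrier W"
proof -
  obtain u v where "red x u" "red y v" using ex_red assms by blast
  then show ?thesis using dem_ldems_rdems(2) [of x u y v] assms redD(1) [of x u] by simp
qed

lemma dem_ldems: "red x u \<Longrightarrow> y \<in> carrier W \<Longrightarrow> dem x y = ldems u y"
  using dem_ldems_rdems(2) ex_red by blast

lemma dem_rdems: "red y v \<Longrightarrow> x \<in> carrier W \<Longrightarrow> dem x y = rdems v x"
  using dem_ldems_rdems(1) ex_red by blast

lemma red_Nil: "red \<one> []"
  by (simp add: reduced_word_def)

lemma red_simple: "i \<in> I \<Longrightarrow> red (s i) [i]"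
  by (simp add: reduced_word_def len_simple)

lemma dem_one_right [simp]: "y \<in> carrier W \<Longrightarrow> dem y \<one> = y"
  using dem_rdems [OF red_Nil] by simp

lemma dem_simple_left: "i \<in> I \<Longrightarrow> y \<in> carrier W \<Longrightarrow> dem (s i) y = ldem i y"
  using dem_ldems [OF red_simple] by simp

lemma dem_simple_right: "i \<in> I \<Longrightarrow> y \<in> carrier W \<Longrightarrow> dem y (s i) = rdem i y"
  using dem_rdems [OF red_simple] by simp

lemma dem_assoc:
  assumes "x \<in> carrier W" "y \<in> carrier W" "z \<in> carrier W"
  shows "dem (dem x y) z = dem x (dem y z)"
proof -
  obtain u v where uv: "red x u" "red z v" using ex_red assms by blast
  show ?thesis
    using assms redD(1) [OF uv(1)] redD(1) [OF uv(2)] ldems_rdems [of u v y]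
    by (simp add: dem_ldems [OF uv(1)] dem_rdems [OF uv(2)])
qed

lemma dem_eq_mult:
  assumes "x \<in> carrier W" "y \<in> carrier W" "len (x \<otimes> y) = len x + len y"
  shows "dem x y = x \<otimes> y"
proof -
  obtain u v where uv: "red x u" "red y v" using ex_red assms by blast
  have "red (x \<otimes> y) (u @ v)"
    using redD(1-3) [OF uv(1)] redD(1-3) [OF uv(2)] assms by (simp add: reduced_word_def wd_append)
  from ldems_red [OF this] show ?thesis
    using ldems_red [OF uv(2)] assms by (simp add: dem_ldems [OF uv(1)])
qed

section \<open>Braid relations and Matsumoto's theorem\<close>

lemma alt_snoc: "alt_word i j (Suc n) = alt_word i j n @ [if even n then i else j]"
  by (induction n arbitrary: i j) auto

lemma alt_double: "alt_word i j (2 * n) = alt_word i j n @ rev (alt_word j i n)"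
proof (induction n arbitrary: i j)
  case (Suc n)
  have "alt_word i j (2 * Suc n) = i # alt_word j i (Suc (2 * n))" by simp
  also have "\<dots> = i # alt_word j i (2 * n) @ [j]" unfolding alt_snoc by simp
  finally show ?case using Suc [of j i] by simp
qed simp

lemma wd_alt_braid:
  assumes "i \<in> I" "j \<in> I"
  shows "wd (alt_word i j (cox_mat W s i j)) = wd (alt_word j i (cox_mat W s i j))"
proof -
  let ?m = "cox_mat W s i j"
  have l: "alt_word i j ?m \<in> lists I" "alt_word j i ?m \<in> lists I"
    using assms alt_lists by metis+
  then have "wd (alt_word i j ?m) \<otimes> inv (wd (alt_word j i ?m)) = \<one>"
    using wd_rel [OF assms] by (simp add: alt_double wd_append wd_rev)
  then show ?thesis using l by (metis inv_closed inv_equality inv_inv wd_closed)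
qed

lemma red_alt_braid:
  assumes "i \<in> I" "j \<in> I"
  shows "red (wd (alt_word i j (cox_mat W s i j))) (alt_word j i (cox_mat W s i j))"
  using red_wd [OF red_alt [OF assms order_refl]] wd_alt_braid [OF assms]
    alt_lists [OF assms(2,1)] by simp

text \<open>Both alternating words are reduced words of the same element \<open>x\<close>, so both operators are
\<open>w \<mapsto> x \<^bold>* w\<close>.\<close>

lemma ldems_braid:
  assumes "i \<in> I" "j \<in> I" "w \<in> carrier W"
  shows "ldems (alt_word i j (cox_mat W s i j)) w = ldems (alt_word j i (cox_mat W s i j)) w"
  using dem_ldems [OF red_alt [OF assms(1,2) order_refl] assms(3)]
    dem_ldems [OF red_alt_braid [OF assms(1,2)] assms(3)] by simp

text \<open>Given a reduced word of \<open>w\<close> that begins with an alternating word of length \<open>n\<close>, exchange the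
descent that its first letter does not account for. A letter cannot be lost from the alternating
prefix, since the alternating word of length \<open>n + 1\<close> is still reduced; so the prefix grows.\<close>

lemma red_alt_prefix:
  assumes "i \<in> I" "j \<in> I" "i \<noteq> j" "w \<in> carrier W"
    and "len (s i \<otimes> w) < len w" "len (s j \<otimes> w) < len w"
  shows "n \<le> cox_mat W s i j \<Longrightarrow>
    (\<exists>t. red w (alt_word i j n @ t)) \<and> (\<exists>t. red w (alt_word j i n @ t))"
proof (induction n)
  case 0
  then show ?case using ex_red assms by simp
next
  case (Suc n)
  have step: "\<exists>t. red w (alt_word b a (Suc n) @ t)"
    if ab: "a \<in> I" "b \<in> I" and d: "len (s b \<otimes> w) < len w"
      and t: "red w (alt_word a b n @ t)" and r: "red (wd (alt_word b a (Suc n))) (alt_word b a (Suc n))" for a b t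
  proof -
    let ?u = "alt_word a b n"
    have I: "?u \<in> lists I" "t \<in> lists I" "?u @ t \<in> lists I"
      using redD(1) [OF t] by auto
    obtain p k q where pq: "?u @ t = p @ k # q" "s b \<otimes> w = wd (p @ q)"
      using exchange [OF ab(2) I(3)] d redD(2) [OF t] by auto
    have bw: "s b \<otimes> w \<in> carrier W" "w = s b \<otimes> (s b \<otimes> w)" using ab assms(4) by auto
    from pq(1) consider t' where "p = ?u @ t'" "t = t' @ k # q"
      | t' where "?u = p @ k # t'" "q = t' @ t"
      by (auto simp: append_eq_append_conv2 append_eq_Cons_conv)
    then show ?thesis
    proof cases
      case 1
      have "wd (alt_word b a (Suc n) @ t' @ q) = w" using 1 pq(2) bw by simp
      then have "red w (alt_word b a (Suc n) @ t' @ q)"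
        by (rule red_wd [OF t, rotated]) (use 1 I ab in auto)
      then show ?thesis by blast
    next
      case 2
      have pt: "p @ t' \<in> lists I" using I 2 by simp
      have "s b \<otimes> (wd ?u \<otimes> wd t) = wd (p @ t') \<otimes> wd t"
        using pq(2) redD(2) [OF t] 2 I pt by (simp add: wd_append m_assoc)
      then have "s b \<otimes> wd ?u = wd (p @ t')" using I pt ab by (simp flip: m_assoc)
      then have "len (wd (alt_word b a (Suc n))) \<le> length (p @ t')"
        using len_le [OF pt] by simp
      moreover have "length (p @ t') < n" using arg_cong [OF 2(1), of length] by simp
      ultimately show ?thesis using redD(3) [OF r] by simp
    qed
  qed
  have "Suc n \<le> cox_mat W s i j" by fact
  moreover have "cox_mat W s j i = cox_mat W s i j"
    using ord_inv [of "s i \<otimes> s j"] assms by (simp add: cox_mat_def inv_mult_group)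
  ultimately have "red (wd (alt_word i j (Suc n))) (alt_word i j (Suc n))"
      "red (wd (alt_word j i (Suc n))) (alt_word j i (Suc n))"
    using red_alt assms by metis+
  then show ?case using Suc step [of i j] step [of j i] assms by (meson Suc_leD)
qed

text \<open>Two reduced words of \<open>w\<close> with the same first letter agree by induction. Words that begin with
different letters \<open>i, j\<close> are compared through the reduced words \<open>i j i \<dots> t\<close> and \<open>j i j \<dots> t\<close>
of \<open>w\<close> with a common tail \<open>t\<close>, which differ by one braid relation.\<close>

lemma matsumoto:
  assumes "monoid H" and h: "\<And>i. i \<in> I \<Longrightarrow> h i \<in> carrier H"
    and braid: "\<And>i j. i \<in> I \<Longrightarrow> j \<in> I \<Longrightarrow> i \<noteq> j \<Longrightarrow>
      word_prod H h (alt_word i j (cox_mat W s i j)) = word_prod H h (alt_word j i (cox_mat W s i j))"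
    and fin: "\<And>i j. i \<in> I \<Longrightarrow> j \<in> I \<Longrightarrow> cox_mat W s i j \<noteq> 0"
  shows "red w u \<Longrightarrow> red w v \<Longrightarrow> word_prod H h u = word_prod H h v"
proof (induction "len w" arbitrary: w u v)
  case 0
  then show ?case using redD(3) [of w u] redD(3) [of w v] by simp
next
  case (Suc n)
  interpret H: monoid H by fact
  let ?hecke_word = "word_prod H h"
  have hecke_word_closed: "?hecke_word u \<in> carrier H" if "u \<in> lists I" for u
    using that by (induction u) (auto simp: word_prod_def h)
  have hecke_word_append: "?hecke_word (u @ v) = ?hecke_word u \<otimes>\<^bsub>H\<^esub> ?hecke_word v" if "u \<in> lists I" "v \<in> lists I" for u v
    using that(1) by (induction u) (use that(2) hecke_word_closed in \<open>auto simp: word_prod_def h H.m_assoc\<close>)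
  have T_Cons: "?hecke_word (i # u) = h i \<otimes>\<^bsub>H\<^esub> ?hecke_word u" for i u by (simp add: word_prod_def)
  have same_head: "?hecke_word (i # u) = ?hecke_word (i # v)" if uv: "red w (i # u)" "red w (i # v)" for i u v
  proof -
    note * = red_Cons [OF uv(1)] red_Cons [OF uv(2)]
    have iI: "i \<in> I" using redD(1) [OF uv(1)] by simp
    have c: "wd u \<in> carrier W" "wd v \<in> carrier W"
      using redD(1) [OF uv(1)] redD(1) [OF uv(2)] by auto
    have eq: "wd u = wd v" using * c iI by (metis simple_cancel)
    have r: "red (wd u) v" using * eq by simp
    have "?hecke_word u = ?hecke_word v" by (rule Suc.hyps(1) [of "wd u"]) (use * r Suc.hyps(2) in auto)
    then show ?thesis by (simp add: T_Cons)
  qed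
  obtain i u' where u: "u = i # u'" using Suc redD(3) [OF Suc.prems(1)] by (cases u) auto
  obtain j v' where v: "v = j # v'" using Suc redD(3) [OF Suc.prems(2)] by (cases v) auto
  have ij: "i \<in> I" "j \<in> I" using redD(1) Suc.prems u v by fastforce+
  show ?case
  proof (cases "i = j")
    case True
    then show ?thesis using same_head Suc.prems u v by blast
  next
    case False
    let ?m = "cox_mat W s i j"
    have wW: "w \<in> carrier W" using redD(4) Suc.prems(1) by blast
    have down: "len (s k \<otimes> w) < len w" if "red w (k # x)" for k x
    proof -
      have "k # x \<in> lists I" using redD(1) [OF that] .
      then have "s k \<otimes> w = wd x" using red_Cons [OF that] by simp
      moreover have "len w = Suc (len (wd x))" using red_Cons [OF that] by blast
      ultimately show ?thesis by simp
    qed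
    \<comment> \<open>both letters are descents of \<open>w\<close>, so the full alternating word can be split off\<close>
    obtain t where t: "red w (alt_word i j ?m @ t)"
      using red_alt_prefix [OF ij False wW, of ?m] down Suc.prems u v by blast
    have tI: "t \<in> lists I" "alt_word i j ?m \<in> lists I" "alt_word j i ?m \<in> lists I"
      using redD(1) [OF t] ij alt_lists [of j I i] by auto
    have t': "red w (alt_word j i ?m @ t)"
      by (rule red_wd [OF t])
         (use tI redD(2) [OF t] wd_alt_braid [OF ij] in \<open>auto simp: wd_append\<close>)
    obtain m' where m': "?m = Suc m'" using fin [OF ij] by (cases ?m) auto
    have "?hecke_word u = ?hecke_word (alt_word i j ?m @ t)"
      using same_head [of i u' "alt_word j i m' @ t"] Suc.prems(1) t u unfolding m' by simp
    also have "\<dots> = ?hecke_word (alt_word j i ?m @ t)"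
      using tI braid [OF ij False] by (simp add: hecke_word_append)
    also have "\<dots> = ?hecke_word v"
      using same_head [of j "alt_word i j m' @ t" v'] Suc.prems(2) t' v unfolding m' by simp
    finally show ?thesis .
  qed
qed

end

section \<open>The 0-Hecke algebra\<close>

lemma carrier_free_alg: "a \<in> carrier (free_alg I) \<longleftrightarrow> (\<forall>w \<in> Poly_Mapping.keys a. letters w \<in> lists I)"
  by (simp add: free_alg_def)

lemma free_alg_simps [simp]:
  "monoid.mult (free_alg I) = (*)" "one (free_alg I) = 1"
  "ring.zero (free_alg I) = 0" "ring.add (free_alg I) = (+)"
  by (simp_all add: free_alg_def)

lemma ring_free_alg: "ring (free_alg I)"
proof (rule ringI)
  show "abelian_group (free_alg I)"
  proof (rule abelian_groupI, goal_cases)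
    case (1 x y)
    then show ?case using keys_add [of x y] by (auto simp: carrier_free_alg)
  next
    case (6 x)
    then show ?case by (intro bexI [of _ "- x"]) (auto simp: carrier_free_alg)
  qed (auto simp: carrier_free_alg add_ac)
  show "monoid (free_alg I)"
  proof (rule monoidI, goal_cases)
    case (1 x y)
    then show ?case using keys_mult [of x y] by (fastforce simp: carrier_free_alg plus_fmon_def)
  next
    case 2
    then show ?case by (auto simp: carrier_free_alg zero_fmon_def)
  qed (auto simp: mult.assoc)
qed (auto simp: algebra_simps)

lemma minus_free_alg: "a \<in> carrier (free_alg I) \<Longrightarrow> b \<in> carrier (free_alg I) \<Longrightarrow> a \<ominus>\<^bsub>free_alg I\<^esub> b = a - b"
proof -
  assume ab: "a \<in> carrier (free_alg I)" "b \<in> carrier (free_alg I)"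
  interpret ring "free_alg I" by (rule ring_free_alg)
  have "\<ominus>\<^bsub>free_alg I\<^esub> b = - b"
    by (rule minus_equality) (use ab in \<open>auto simp: carrier_free_alg\<close>)
  then show ?thesis by (simp add: a_minus_def)
qed

lemma monomial_closed: "u \<in> lists I \<Longrightarrow> monomial u \<in> carrier (free_alg I)"
  by (simp add: carrier_free_alg monomial_def)

lemma monomial_Nil: "monomial [] = 1"
  by (simp add: monomial_def zero_fmon_def flip: single_one)

lemma monomial_mult: "monomial u * monomial v = monomial (u @ v)"
  by (simp add: monomial_def mult_single plus_fmon_def)

context coxeter_group
begin

lemma hecke_rels_closed: "hecke_rels W I s \<subseteq> carrier (free_alg I)"
proof -
  interpret ring "free_alg I" by (rule ring_free_alg)
  have "monomial u - monomial v \<in> carrier (free_alg I)" if "u \<in> lists I" "v \<in> lists I" for u v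
    using monomial_closed [OF that(1)] monomial_closed [OF that(2)]
      minus_free_alg [OF monomial_closed [OF that(1)] monomial_closed [OF that(2)]] minus_closed by metis
  then show ?thesis by (auto simp: hecke_rels_def alt_lists)
qed

lemma hecke_ideal: "ideal (hecke_ideal W I s) (free_alg I)"
  unfolding hecke_ideal_def by (rule ring.genideal_ideal [OF ring_free_alg hecke_rels_closed])

lemma ring_hecke: "ring (hecke W I s)"
  unfolding hecke_def by (rule ideal.quotient_is_ring [OF hecke_ideal])

abbreviation hcos :: "('i fmon \<Rightarrow>\<^sub>0 int) \<Rightarrow> ('i fmon \<Rightarrow>\<^sub>0 int) set" where
  "hcos a \<equiv> hecke_ideal W I s +>\<^bsub>free_alg I\<^esub> a"

lemma hcos_hom: "hcos \<in> ring_hom (free_alg I) (hecke W I s)"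
  unfolding hecke_def by (rule ideal.rcos_ring_hom [OF hecke_ideal])

abbreviation hecke_word :: "'i list \<Rightarrow> ('i fmon \<Rightarrow>\<^sub>0 int) set" where
  "hecke_word \<equiv> word_prod (hecke W I s) (hecke_gen W I s)"

lemma hecke_word_monomial: "u \<in> lists I \<Longrightarrow> hecke_word u = hcos (monomial u)"
proof (induction u)
  case Nil
  then show ?case using ring_hom_one [OF hcos_hom] by (simp add: word_prod_def monomial_Nil)
next
  case (Cons i u)
  then show ?case
    using ring_hom_mult [OF hcos_hom monomial_closed monomial_closed, of "[i]" u]
    by (simp add: word_prod_def hecke_gen_def monomial_mult)
qed

lemma hecke_word_eq_iff:
  assumes "u \<in> lists I" "v \<in> lists I"
  shows "hecke_word u = hecke_word v \<longleftrightarrow> monomial u - monomial v \<in> hecke_ideal W I s"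
  using ring.quotient_eq_iff_same_a_r_cos [OF ring_free_alg hecke_ideal
      monomial_closed [OF assms(1)] monomial_closed [OF assms(2)]]
    minus_free_alg [OF monomial_closed [OF assms(1)] monomial_closed [OF assms(2)]]
  by (simp add: hecke_word_monomial assms)

lemma hecke_word_rel:
  assumes "u \<in> lists I" "v \<in> lists I" "monomial u - monomial v \<in> hecke_rels W I s"
  shows "hecke_word u = hecke_word v"
  unfolding hecke_word_eq_iff [OF assms(1,2)] hecke_ideal_def
  using ring.genideal_self [OF ring_free_alg hecke_rels_closed] assms(3) by blast

lemma hecke_word_quadratic: "i \<in> I \<Longrightarrow> hecke_word [i, i] = hecke_word [i]"
  by (rule hecke_word_rel) (auto simp: hecke_rels_def)

lemma hecke_word_braid:
  "i \<in> I \<Longrightarrow> j \<in> I \<Longrightarrow> i \<noteq> j \<Longrightarrow> hecke_word (alt_word i j (cox_mat W s i j)) = hecke_word (alt_word j i (cox_mat W s i j))"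
  by (rule hecke_word_rel) (auto simp: hecke_rels_def alt_lists)

lemma hecke_word_append:
  assumes "u \<in> lists I" "v \<in> lists I"
  shows "hecke_word (u @ v) = hecke_word u \<otimes>\<^bsub>hecke W I s\<^esub> hecke_word v"
  using ring_hom_mult [OF hcos_hom monomial_closed monomial_closed, of u v] assms
  by (simp add: hecke_word_monomial monomial_mult)

lemma hecke_word_closed: "u \<in> lists I \<Longrightarrow> hecke_word u \<in> carrier (hecke W I s)"
  using ring_hom_closed [OF hcos_hom monomial_closed] by (simp add: hecke_word_monomial)

text \<open>Distinct elements \<open>T'\<^sub>w\<close> are separated by a representation: a word acts on \<open>W\<close> by Demazure
operators, and \<open>word_action\<close> is the linear extension of this monoid homomorphism with values in
the free abelian group on the functions from \<open>W\<close> to \<open>W\<close>. Its kernel is an ideal that contains the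
defining relations.\<close>

definition word_action :: "('i fmon \<Rightarrow>\<^sub>0 int) \<Rightarrow> (('w \<Rightarrow> 'w) \<Rightarrow>\<^sub>0 int)" where
  "word_action = frag_extend (\<lambda>u. frag_of (ldems (letters u)))"

lemma word_action_simps:
  "word_action 0 = 0" "word_action (a + b) = word_action a + word_action b" "word_action (a - b) = word_action a - word_action b"
  "word_action (frag_of u) = frag_of (ldems (letters u))" "word_action (monomial v) = frag_of (ldems v)"
  by (simp_all add: word_action_def frag_extend_add frag_extend_diff monomial_def)

lemma ldems_append: "ldems (u @ v) = (\<lambda>w. ldems u (ldems v w))"
  by (simp add: fun_eq_iff)

text \<open>The two multiplication rules say no more than that \<open>word_action\<close> is multiplicative for composition of
functions; stated one generator at a time, they show that the kernel is a two-sided ideal.\<close>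

lemma word_action_left: "word_action (frag_of u * a) = frag_extend (\<lambda>f. frag_of (ldems (letters u) \<circ> f)) (word_action a)"
  using subset_UNIV [of "Poly_Mapping.keys a"]
proof (induction a rule: frag_induction)
  case (one v)
  then show ?case by (simp add: word_action_simps mult_single plus_fmon_def comp_def ldems_append)
qed (simp_all add: word_action_simps frag_extend_diff right_diff_distrib)

lemma word_action_right: "word_action (a * frag_of u) = frag_extend (\<lambda>f. frag_of (f \<circ> ldems (letters u))) (word_action a)"
  using subset_UNIV [of "Poly_Mapping.keys a"]
proof (induction a rule: frag_induction)
  case (one v)
  then show ?case by (simp add: word_action_simps mult_single plus_fmon_def comp_def ldems_append)
qed (simp_all add: word_action_simps frag_extend_diff left_diff_distrib)

lemma word_action_mult_0:
  assumes "word_action a = 0"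
  shows "word_action (b * a) = 0" "word_action (a * b) = 0"
proof -
  show "word_action (b * a) = 0" using subset_UNIV [of "Poly_Mapping.keys b"]
    by (induction b rule: frag_induction) (simp_all add: word_action_simps word_action_left assms left_diff_distrib)
  show "word_action (a * b) = 0" using subset_UNIV [of "Poly_Mapping.keys b"]
    by (induction b rule: frag_induction) (simp_all add: word_action_simps word_action_right assms right_diff_distrib)
qed

lemma ideal_word_action: "ideal {a \<in> carrier (free_alg I). word_action a = 0} (free_alg I)"
proof -
  interpret R: ring "free_alg I" by (rule ring_free_alg)
  show ?thesis
  proof (rule idealI)
    show "subgroup {a \<in> carrier (free_alg I). word_action a = 0} (add_monoid (free_alg I))"
    proof (rule R.add.subgroupI)
      show "{a \<in> carrier (free_alg I). word_action a = 0} \<noteq> {}"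
        using R.zero_closed by (auto simp: word_action_simps)
    next
      fix a assume a: "a \<in> {a \<in> carrier (free_alg I). word_action a = 0}"
      then have "word_action (a + \<ominus>\<^bsub>free_alg I\<^esub> a) = 0" using R.r_neg [of a] by (simp add: word_action_simps)
      then show "\<ominus>\<^bsub>free_alg I\<^esub> a \<in> {a \<in> carrier (free_alg I). word_action a = 0}"
        using a R.a_inv_closed [of a] by (simp add: word_action_simps)
    next
      fix a b assume "a \<in> {a \<in> carrier (free_alg I). word_action a = 0}" "b \<in> {a \<in> carrier (free_alg I). word_action a = 0}"
      then show "a \<oplus>\<^bsub>free_alg I\<^esub> b \<in> {a \<in> carrier (free_alg I). word_action a = 0}"
        using R.a_closed [of a b] by (simp add: word_action_simps)
    qed auto
  next
    fix a x assume "a \<in> {a \<in> carrier (free_alg I). word_action a = 0}" "x \<in> carrier (free_alg I)"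
    then show "x \<otimes>\<^bsub>free_alg I\<^esub> a \<in> {a \<in> carrier (free_alg I). word_action a = 0}"
      "a \<otimes>\<^bsub>free_alg I\<^esub> x \<in> {a \<in> carrier (free_alg I). word_action a = 0}"
      using R.m_closed [of a x] R.m_closed [of x a] by (simp_all add: word_action_mult_0)
  qed (rule ring_free_alg)
qed

lemma ldems_id: "w \<notin> carrier W \<Longrightarrow> ldems u w = w"
  by (induction u) (auto simp: ldem_def)

lemma hecke_ideal_word_action: "a \<in> hecke_ideal W I s \<Longrightarrow> word_action a = 0"
proof -
  have "ldems (alt_word i j (cox_mat W s i j)) = ldems (alt_word j i (cox_mat W s i j))"
    if "i \<in> I" "j \<in> I" for i j
  proof
    fix w show "ldems (alt_word i j (cox_mat W s i j)) w = ldems (alt_word j i (cox_mat W s i j)) w"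
      using ldems_braid [OF that, of w] ldems_id [of w] by (cases "w \<in> carrier W") simp_all
  qed
  moreover have "ldems [i, i] = ldems [i]" if "i \<in> I" for i
    using that by (auto simp: ldem_idem)
  moreover have "(\<exists>u v. a = monomial u - monomial v \<and> ldems u = ldems v) \<Longrightarrow> word_action a = 0" for a
    by (auto simp: word_action_simps)
  ultimately have "word_action a = 0" if "a \<in> hecke_rels W I s" for a
    using that unfolding hecke_rels_def by blast
  then have "hecke_rels W I s \<subseteq> {a \<in> carrier (free_alg I). word_action a = 0}"
    using hecke_rels_closed by blast
  from ring.genideal_minimal [OF ring_free_alg ideal_word_action this]
  show "a \<in> hecke_ideal W I s \<Longrightarrow> word_action a = 0" unfolding hecke_ideal_def by blast
qed

lemma hecke_word_eq_imp_ldems: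
  assumes "u \<in> lists I" "v \<in> lists I" "hecke_word u = hecke_word v"
  shows "ldems u = ldems v"
  using hecke_ideal_word_action [of "monomial u - monomial v"] assms
  by (simp add: hecke_word_eq_iff word_action_simps frag_of_eq)

end

text \<open>Finiteness ensures \<open>m(i,j) \<noteq> 0\<close>, so that every pair of generators has a genuine braid relation,
and it provides the longest elements.\<close>

locale finite_coxeter_group = coxeter_group W I s
  for W :: "('w, 'b) monoid_scheme" (structure) and I :: "'i set" and s :: "'i \<Rightarrow> 'w" +
  assumes fin: "finite (carrier W)"
begin

lemma hecke_word_red: "red w u \<Longrightarrow> red w v \<Longrightarrow> hecke_word u = hecke_word v"
proof (rule matsumoto)
  show "monoid (hecke W I s)" using ring_hecke by (rule ring.is_monoid)
next
  fix i assume "i \<in> I"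
  then show "hecke_gen W I s i \<in> carrier (hecke W I s)"
    using ring_hom_closed [OF hcos_hom monomial_closed, of "[i]"] by (simp add: hecke_gen_def)
next
  fix i j assume "i \<in> I" "j \<in> I"
  then show "cox_mat W s i j \<noteq> 0"
    using ord_ge_1 [OF fin, of "s i \<otimes> s j"] by (simp add: cox_mat_def)
qed (rule hecke_word_braid)

lemma hecke_basis_eq: "red w u \<Longrightarrow> hecke_basis W I s w = hecke_word u"
  unfolding hecke_basis_def by (rule hecke_word_red [OF someI [of "red w" u]])

text \<open>Acting on \<open>1\<close>, a reduced word of \<open>w\<close> gives back \<open>w\<close>.\<close>

lemma hecke_basis_inj:
  assumes "x \<in> carrier W" "y \<in> carrier W" "hecke_basis W I s x = hecke_basis W I s y"
  shows "x = y"
proof -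
  obtain u v where uv: "red x u" "red y v" using ex_red assms by blast
  have "hecke_word u = hecke_word v" using assms(3) by (simp only: hecke_basis_eq [OF uv(1)] hecke_basis_eq [OF uv(2)])
  then have "ldems u = ldems v"
    by (rule hecke_word_eq_imp_ldems [OF redD(1) [OF uv(1)] redD(1) [OF uv(2)]])
  then have "ldems u \<one> = ldems v \<one>" by simp
  then show ?thesis unfolding ldems_red [OF uv(1)] ldems_red [OF uv(2)] .
qed

lemma hecke_basis_ldem:
  assumes "i \<in> I" "w \<in> carrier W"
  shows "hecke_word [i] \<otimes>\<^bsub>hecke W I s\<^esub> hecke_basis W I s w = hecke_basis W I s (ldem i w)"
proof (rule ldem_cases [OF assms])
  assume *: "len (s i \<otimes> w) = Suc (len w)" "ldem i w = s i \<otimes> w"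
  obtain u where u: "red w u" using ex_red assms by blast
  then have "red (s i \<otimes> w) (i # u)" using * assms redD(1-3) [OF u] by (simp add: reduced_word_def)
  then show ?thesis
    using hecke_word_append [of "[i]" u] redD(1) [OF u] assms * by (simp add: hecke_basis_eq [OF u] hecke_basis_eq)
next
  assume *: "len w = Suc (len (s i \<otimes> w))" "ldem i w = w"
  obtain u where u: "red (s i \<otimes> w) u" using ex_red [of "s i \<otimes> w"] assms by auto
  have uI: "u \<in> lists I" using redD(1) [OF u] .
  have r: "red w (i # u)" using * assms redD(1-3) [OF u] by (simp add: reduced_word_def)
  have "hecke_word [i] \<otimes>\<^bsub>hecke W I s\<^esub> hecke_word (i # u) = hecke_word ([i, i] @ u)"
    using hecke_word_append [of "[i]" "i # u"] uI assms by simp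
  also have "\<dots> = hecke_word [i] \<otimes>\<^bsub>hecke W I s\<^esub> hecke_word u"
    using hecke_word_append [of "[i, i]" u] uI assms by (simp add: hecke_word_quadratic)
  also have "\<dots> = hecke_word (i # u)" using hecke_word_append [of "[i]" u] uI assms by simp
  finally show ?thesis by (simp add: hecke_basis_eq [OF r] *)
qed

lemma hecke_basis_mult:
  assumes "x \<in> carrier W" "y \<in> carrier W"
  shows "hecke_basis W I s x \<otimes>\<^bsub>hecke W I s\<^esub> hecke_basis W I s y = hecke_basis W I s (dem x y)"
proof -
  interpret H: ring "hecke W I s" by (rule ring_hecke)
  obtain u v where u: "red x u" and v: "red y v" using ex_red assms by blast
  have yc: "hecke_basis W I s y \<in> carrier (hecke W I s)"
    using hecke_word_closed redD(1) [OF v] hecke_basis_eq [OF v] by simp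
  have "hecke_word u \<otimes>\<^bsub>hecke W I s\<^esub> hecke_basis W I s y = hecke_basis W I s (ldems u y)" if "u \<in> lists I" for u
    using that
  proof (induction u)
    case Nil
    then show ?case using yc by (simp add: word_prod_def)
  next
    case (Cons i u)
    then have iu: "i \<in> I" "u \<in> lists I" by auto
    then have "hecke_word (i # u) = hecke_word [i] \<otimes>\<^bsub>hecke W I s\<^esub> hecke_word u" using hecke_word_append [of "[i]" u] by simp
    moreover have "hecke_word [i] \<in> carrier (hecke W I s)" "hecke_word u \<in> carrier (hecke W I s)"
      using hecke_word_closed Cons by auto
    ultimately have "hecke_word (i # u) \<otimes>\<^bsub>hecke W I s\<^esub> hecke_basis W I s y
        = hecke_word [i] \<otimes>\<^bsub>hecke W I s\<^esub> hecke_basis W I s (ldems u y)"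
      using Cons yc by (simp add: H.m_assoc)
    also have "\<dots> = hecke_basis W I s (ldems (i # u) y)"
      using hecke_basis_ldem [OF iu(1) ldems_closed [OF iu(2) assms(2)]] by simp
    finally show ?case .
  qed
  from this [OF redD(1) [OF u]] show ?thesis
    using hecke_basis_eq [OF u] dem_ldems [OF u assms(2)] by simp
qed

lemma demazure_eq:
  assumes "x \<in> carrier W" "y \<in> carrier W"
  shows "demazure W I s x y = dem x y"
  unfolding demazure_def
  by (rule the_equality) (use assms hecke_basis_inj hecke_basis_mult in auto)

end

section \<open>Parabolic subgroups\<close>

context coxeter_group
begin

text \<open>When a new letter shortens the element, exchange deletes a letter from the reduced word already
found, so the word stays inside \<open>J\<close>.\<close>

lemma parabolic_red:
  assumes "J \<subseteq> I" "x \<in> parabolic W s J"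
  shows "\<exists>u \<in> lists J. red x u"
proof -
  have "\<exists>v \<in> lists J. red (wd u) v" if "u \<in> lists J" for u
    using that
  proof (induction u rule: list.induct)
    case Nil
    then show ?case using red_Nil by auto
  next
    case (Cons i u)
    then obtain v where v: "v \<in> lists J" "red (wd u) v" by auto
    have i: "i \<in> J" "i \<in> I" using Cons.prems assms(1) by auto
    have vu: "wd v = wd u" "length v = len (wd u)" "v \<in> lists I" "wd u \<in> carrier W"
      using redD [OF v(2)] by auto
    show ?case
    proof (rule len_simple_cases [OF i(2) vu(4)])
      assume "len (s i \<otimes> wd u) = Suc (len (wd u))"
      then have "red (wd (i # u)) (i # v)" using vu i by (simp add: reduced_word_def)
      then show ?thesis using v(1) i by (intro bexI [of _ "i # v"]) auto
    next
      assume d: "len (wd u) = Suc (len (s i \<otimes> wd u))"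
      then obtain p k q where pq: "v = p @ k # q" "s i \<otimes> wd v = wd (p @ q)"
        using exchange [OF i(2) vu(3)] vu(1) by auto
      have "p @ q \<in> lists I" using vu(3) pq(1) by simp
      moreover have "length (p @ q) = len (s i \<otimes> wd u)" using d vu(2) pq(1) by simp
      ultimately have "red (wd (i # u)) (p @ q)" using pq(2) vu(1) by (simp add: reduced_word_def)
      then show ?thesis using v(1) pq(1) by (intro bexI [of _ "p @ q"]) auto
    qed
  qed
  then show ?thesis using parabolic_word [OF assms] by blast
qed

lemma parabolic_descent:
  assumes "J \<subseteq> I" "x \<in> parabolic W s J" "i \<in> I" "len (s i \<otimes> x) < len x"
  shows "i \<in> J"
proof -
  obtain u where u: "u \<in> lists J" "red x u" using parabolic_red [OF assms(1,2)] by blast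
  note u' = redD(1) [OF u(2)] redD(2) [OF u(2)] redD(4) [OF u(2)]
  obtain p k q where pq: "u = p @ k # q" "s i \<otimes> x = wd (p @ q)"
    using exchange [OF assms(3) u'(1)] assms(4) u'(2) by auto
  have "p @ q \<in> lists J" using u(1) pq(1) by simp
  then have "s i \<otimes> x \<otimes> inv x \<in> parabolic W s J"
    unfolding pq(2) using parabolic_wd parabolic_mult parabolic_inv [OF assms(1,2)] by blast
  then have "s i \<in> parabolic W s J" using assms(3) u'(3) by (simp add: m_assoc)
  then obtain v where v: "v \<in> lists J" "red (s i) v" using parabolic_red [OF assms(1)] by blast
  then obtain j where j: "v = [j]"
    using redD(3) [OF v(2)] len_simple [OF assms(3)] by (auto simp: length_Suc_conv)
  then have "s j = s i" "j \<in> J" using redD(2) [OF v(2)] v(1) redD(1) [OF v(2)] by auto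
  then show ?thesis using simple_inj assms(1,3) by (auto dest: inj_onD)
qed

lemma dem_absorb:
  assumes "J \<subseteq> I" "x \<in> parabolic W s J" "w \<in> carrier W" "\<And>j. j \<in> J \<Longrightarrow> ldem j w = w"
  shows "dem x w = w"
proof -
  obtain u where u: "u \<in> lists J" "red x u" using parabolic_red [OF assms(1,2)] by blast
  have "ldems u w = w" using u(1) by (induction u rule: list.induct) (auto simp: assms(4))
  then show ?thesis using dem_ldems [OF u(2) assms(3)] by simp
qed

lemma inv_dem:
  assumes "x \<in> carrier W" "y \<in> carrier W"
  shows "inv (dem x y) = dem (inv y) (inv x)"
proof -
  obtain u where u: "red x u" using ex_red assms by blast
  then show ?thesis
    using dem_ldems [OF u assms(2)] dem_rdems [OF red_rev [OF u], of "inv y"] inv_ldems [of u y]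
      redD(1) [OF u] assms by simp
qed

lemma dem_absorb_right:
  assumes "J \<subseteq> I" "x \<in> parabolic W s J" "w \<in> carrier W" "\<And>j. j \<in> J \<Longrightarrow> ldem j (inv w) = inv w"
  shows "dem w x = w"
proof -
  have x: "x \<in> carrier W" using parabolic_closed assms by blast
  have "inv (dem w x) = inv w"
    using inv_dem [OF assms(3) x] dem_absorb [OF assms(1) parabolic_inv [OF assms(1,2)], of "inv w"]
      assms by simp
  then have "inv (inv (dem w x)) = inv (inv w)" by simp
  then show ?thesis using x assms(3) by simp
qed

text \<open>Compute \<open>y\<^sup>-\<^sup>1 \<^bold>* x\<close> in two ways: \<open>x\<close> absorbs \<open>W\<^sub>J\<close> from the left and \<open>y\<^sup>-\<^sup>1\<close> absorbs it from the
right. With \<open>x = y\<close> this gives that the element is an involution, and then uniqueness.\<close>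

lemma absorbing_unique:
  assumes "J \<subseteq> I" "x \<in> parabolic W s J" "y \<in> parabolic W s J"
    and "\<And>j. j \<in> J \<Longrightarrow> ldem j x = x" "\<And>j. j \<in> J \<Longrightarrow> ldem j y = y"
  shows "x = inv y"
proof -
  have c: "x \<in> carrier W" "y \<in> carrier W" using parabolic_closed assms by blast+
  have "dem (inv y) x = x"
    by (rule dem_absorb [OF assms(1) parabolic_inv [OF assms(1,3)] c(1) assms(4)])
  moreover have "dem (inv y) x = inv y"
    by (rule dem_absorb_right [OF assms(1,2)]) (use c assms(5) in auto)
  ultimately show ?thesis by simp
qed

lemma ldems_parabolic:
  assumes "J \<subseteq> I" "w \<in> carrier W" "u \<in> lists J"
  shows "\<exists>x \<in> parabolic W s J. ldems u w = x \<otimes> w"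
  using assms(3)
proof (induction u rule: list.induct)
  case Nil
  then show ?case using parabolic_Nil assms(2) by (intro bexI [of _ \<one>]) auto
next
  case (Cons i u)
  then obtain x where x: "x \<in> parabolic W s J" "ldems u w = x \<otimes> w" and i: "i \<in> J" by auto
  have c: "x \<in> carrier W" "i \<in> I" using parabolic_closed [OF assms(1) x(1)] i assms(1) by auto
  show ?case
  proof (cases "ldem i (x \<otimes> w) = x \<otimes> w")
    case True
    then show ?thesis using x by auto
  next
    case False
    then have "ldem i (x \<otimes> w) = s i \<otimes> (x \<otimes> w)" using ldem_up c assms(2) by simp
    then show ?thesis using x c assms(2) parabolic_mult [OF parabolic_simple [OF i] x(1)]
      by (intro bexI [of _ "s i \<otimes> x"]) (auto simp: m_assoc)
  qed
qed

lemma parabolic_disjoint: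
  assumes "A \<subseteq> I" "C \<subseteq> I" "A \<inter> C = {}" "x \<in> parabolic W s A" "x \<in> parabolic W s C"
  shows "x = \<one>"
proof -
  obtain u where u: "u \<in> lists A" "red x u" using parabolic_red [OF assms(1,4)] by blast
  show ?thesis
  proof (cases u)
    case Nil
    then show ?thesis using redD(2) [OF u(2)] by simp
  next
    case (Cons i v)
    have r: "red x (i # v)" using u(2) Cons by simp
    have i: "i \<in> A" "i \<in> I" using u(1) Cons assms(1) by auto
    have "v \<in> lists I" using redD(1) [OF r] by simp
    then have "s i \<otimes> x = wd v" using red_Cons [OF r] i by simp
    moreover have "len x = Suc (len (wd v))" using red_Cons [OF r] by blast
    ultimately have "i \<in> C" by (intro parabolic_descent [OF assms(2,5) i(2)]) simp
    then show ?thesis using i assms(3) by blast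
  qed
qed

text \<open>Let a reduced word of \<open>x\<close> followed by one of \<open>y\<close> fail to be reduced at some letter \<open>i\<close> of the first
word. Exchange deletes a letter of the second word, and a conjugate of \<open>s\<^sub>i\<close> inside \<open>W\<^sub>C\<close> is then
also in \<open>W\<^sub>A\<close>, which meets \<open>W\<^sub>C\<close> trivially.\<close>

lemma len_mult_disjoint:
  assumes "A \<subseteq> I" "C \<subseteq> I" "A \<inter> C = {}" "x \<in> parabolic W s C" "y \<in> parabolic W s A"
  shows "len (x \<otimes> y) = len x + len y"
proof -
  obtain v where v: "v \<in> lists A" "red y v" using parabolic_red [OF assms(1,5)] by blast
  note v' = redD(1) [OF v(2)] redD(2) [OF v(2)] redD(3) [OF v(2)] redD(4) [OF v(2)]
  have "len (wd u \<otimes> y) = length u + len y" if "u \<in> lists C" "red (wd u) u" for u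
    using that
  proof (induction u rule: list.induct)
    case Nil
    then show ?case using v' by simp
  next
    case (Cons i u)
    have i: "i \<in> C" "i \<in> I" and uC: "u \<in> lists C" and uI: "u \<in> lists I" and r: "red (wd u) u"
      using Cons.prems(1) assms(2) red_Cons [OF Cons.prems(2)] redD(1) [OF Cons.prems(2)] by auto
    have l: "len (wd u \<otimes> y) = length u + len y" by (rule Cons.IH [OF uC r])
    have uy: "wd u \<otimes> y \<in> carrier W" using uI v' by simp
    show ?case
    proof (rule len_simple_cases [OF i(2) uy])
      assume "len (s i \<otimes> (wd u \<otimes> y)) = Suc (len (wd u \<otimes> y))"
      then show ?thesis using l i uI v' by (simp add: m_assoc)
    next
      assume d: "len (wd u \<otimes> y) = Suc (len (s i \<otimes> (wd u \<otimes> y)))"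
      have uv: "u @ v \<in> lists I" "wd (u @ v) = wd u \<otimes> y" using uI v' by (auto simp: wd_append)
      obtain p k q where pq: "u @ v = p @ k # q" "s i \<otimes> (wd u \<otimes> y) = wd (p @ q)"
        using exchange [OF i(2) uv(1)] d unfolding uv(2) by auto
      from pq(1) consider t where "p = u @ t" "v = t @ k # q"
        | t where "u = p @ k # t" "q = t @ v"
        by (auto simp: append_eq_append_conv2 append_eq_Cons_conv)
      then have False
      proof cases
        case 1
        have tq: "t @ q \<in> lists A" "t @ q \<in> lists I" using 1(2) v(1) v'(1) by auto
        \<comment> \<open>conjugating by the prefix isolates the deleted letter of the second word\<close>
        define z where "z = inv (wd u) \<otimes> s i \<otimes> wd u"
        have "s i \<otimes> (wd u \<otimes> y) = wd u \<otimes> wd (t @ q)"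
          using pq(2) 1(1) uI tq wd_append [of u "t @ q"] by simp
        then have "inv (wd u) \<otimes> (s i \<otimes> (wd u \<otimes> y)) \<otimes> inv y
            = inv (wd u) \<otimes> (wd u \<otimes> wd (t @ q)) \<otimes> inv y"
          by simp
        then have "z = wd (t @ q) \<otimes> inv y"
          using i uI v' wd_closed [OF tq(2)]
          by (simp add: z_def m_assoc r_inv) (simp flip: m_assoc)
        then have "z \<in> parabolic W s A"
          using parabolic_mult [OF parabolic_wd [OF tq(1)] parabolic_inv [OF assms(1,5)]] by simp
        moreover have "z \<in> parabolic W s C"
          unfolding z_def using parabolic_wd [OF uC] parabolic_inv [OF assms(2)] i
          by (intro parabolic_mult parabolic_simple) auto
        ultimately have "z = \<one>" using parabolic_disjoint [OF assms(1,2,3)] by blast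
        then have "wd u \<otimes> z \<otimes> inv (wd u) = \<one>" using uI by simp
        then have "s i = \<one>" using i uI by (simp add: z_def m_assoc) (simp flip: m_assoc)
        then show False using simple_not_one [OF i(2)] by blast
      next
        case 2
        have pt: "p @ t \<in> lists I" using uI 2(1) by simp
        have "s i \<otimes> wd u \<otimes> y = wd (p @ t) \<otimes> y"
          using pq(2) 2(2) pt v' i uI wd_append [of "p @ t" v] by (simp add: m_assoc)
        then have "wd (i # u) = wd (p @ t)" using i uI v' wd_closed [OF pt] by simp
        then have "len (wd (i # u)) \<le> length (p @ t)" using len_le [OF pt] by simp
        then show False using redD(3) [OF Cons.prems(2)] 2(1) by simp
      qed
      then show ?thesis ..
    qed
  qed
  note * = this
  obtain u where u: "u \<in> lists C" "red x u" using parabolic_red [OF assms(2,4)] by blast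
  note x = redD(2) [OF u(2)] redD(3) [OF u(2)]
  show ?thesis using * [OF u(1)] u(2) unfolding x by simp
qed

lemma parabolic_commute:
  assumes "A \<subseteq> I" "C \<subseteq> I" "\<And>a c. a \<in> A \<Longrightarrow> c \<in> C \<Longrightarrow> s a \<otimes> s c = s c \<otimes> s a"
    and "x \<in> parabolic W s A" "y \<in> parabolic W s C"
  shows "x \<otimes> y = y \<otimes> x"
proof -
  have one: "s a \<otimes> wd v = wd v \<otimes> s a" if "a \<in> A" "v \<in> lists C" for a v
    using that(2)
  proof (induction v rule: list.induct)
    case (Cons c v)
    have c: "a \<in> I" "c \<in> I" "wd v \<in> carrier W"
      using Cons.prems that(1) assms(1,2) lists_mono [OF assms(2)] by auto
    have "s a \<otimes> wd (c # v) = s a \<otimes> s c \<otimes> wd v" using c by (simp add: m_assoc)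
    also have "\<dots> = s c \<otimes> (s a \<otimes> wd v)" using c assms(3) [OF that(1), of c] Cons.prems by (simp add: m_assoc)
    also have "\<dots> = wd (c # v) \<otimes> s a" using c Cons by (simp add: m_assoc)
    finally show ?case .
  qed (use that(1) assms(1) in auto)
  obtain u where u: "u \<in> lists A" "wd u = x" using parabolic_word [OF assms(1,4)] by blast
  obtain v where v: "v \<in> lists C" "wd v = y" using parabolic_word [OF assms(2,5)] by blast
  have vI: "wd v \<in> carrier W" using wd_closed lists_mono [OF assms(2)] v(1) by blast
  have "wd u \<otimes> wd v = wd v \<otimes> wd u" using u(1)
  proof (induction u rule: list.induct)
    case (Cons a u)
    have c: "a \<in> I" "wd u \<in> carrier W"
      using Cons.prems assms(1) lists_mono [OF assms(1)] by auto
    have "wd (a # u) \<otimes> wd v = s a \<otimes> wd v \<otimes> wd u" using c vI Cons by (simp add: m_assoc)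
    also have "\<dots> = wd v \<otimes> wd (a # u)" using c vI one [of a v] Cons.prems v(1) by (simp add: m_assoc)
    finally show ?case .
  qed (use vI in auto)
  then show ?thesis using u v by simp
qed

end

section \<open>Longest elements\<close>

context finite_coxeter_group
begin

abbreviation lg :: "'i set \<Rightarrow> 'w" where "lg \<equiv> longest W I s"

text \<open>An element of maximal length in \<open>W\<^sub>J\<close> is fixed by the operators with index in \<open>J\<close>, and this
property determines it by \<open>absorbing_unique\<close>.\<close>

lemma longest_absorbing:
  assumes "J \<subseteq> I"
  shows "lg J \<in> parabolic W s J \<and> (\<forall>v \<in> parabolic W s J. len v \<le> len (lg J)) \<and>
    (\<forall>j \<in> J. ldem j (lg J) = lg J)"
proof -
  let ?P = "parabolic W s J"
  let ?max = "\<lambda>w. w \<in> ?P \<and> (\<forall>v \<in> ?P. len v \<le> len w)"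
  have abs: "ldem j w = w" if w: "?max w" and j: "j \<in> J" for j w
  proof -
    have "s j \<otimes> w \<in> ?P" using parabolic_mult [OF parabolic_simple [OF j]] w by blast
    then have "len (s j \<otimes> w) \<le> len w" using w by blast
    then show ?thesis by (simp add: ldem_def)
  qed
  have P: "?P \<subseteq> carrier W" using parabolic_closed [OF assms] by blast
  have finP: "finite (len ` ?P)" by (rule finite_imageI [OF finite_subset [OF P fin]])
  have "Max (len ` ?P) \<in> len ` ?P"
    by (rule Max_in [OF finP]) (use parabolic_Nil [of J] in blast)
  then obtain w where w': "Max (len ` ?P) = len w" "w \<in> ?P" by (rule imageE)
  have w: "?max w" using Max_ge [OF finP] w' by (metis imageI)
  have uniq: "v = inv w" if "?max v" for v
    using absorbing_unique [OF assms, of v w] abs that w by blast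
  have "lg J = w" unfolding longest_def
    by (rule the_equality) (use w uniq [OF w] uniq in auto)
  then show ?thesis using w abs by blast
qed

lemma lg_parabolic: "J \<subseteq> I \<Longrightarrow> lg J \<in> parabolic W s J"
  using longest_absorbing by blast

lemma lg_closed [simp]: "J \<subseteq> I \<Longrightarrow> lg J \<in> carrier W"
  using lg_parabolic parabolic_closed by blast

lemma ldem_lg: "J \<subseteq> I \<Longrightarrow> j \<in> J \<Longrightarrow> ldem j (lg J) = lg J"
  using longest_absorbing by blast

lemma inv_lg: "J \<subseteq> I \<Longrightarrow> inv (lg J) = lg J"
  by (rule absorbing_unique [OF _ lg_parabolic lg_parabolic ldem_lg ldem_lg, symmetric])

lemma lg_square: "J \<subseteq> I \<Longrightarrow> lg J \<otimes> lg J = \<one>"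
  using r_inv [of "lg J"] inv_lg by simp

lemma lg_cancel: "J \<subseteq> I \<Longrightarrow> x \<in> carrier W \<Longrightarrow> lg J \<otimes> (lg J \<otimes> x) = x"
  by (simp add: lg_square flip: m_assoc)

lemma lg_eqI:
  assumes "J \<subseteq> I" "x \<in> parabolic W s J" "\<And>j. j \<in> J \<Longrightarrow> ldem j x = x"
  shows "x = lg J"
  using absorbing_unique [OF assms(1,2) lg_parabolic [OF assms(1)] assms(3) ldem_lg [OF assms(1)]]
    inv_lg [OF assms(1)] by simp

lemma ldem_lg_iff: "J \<subseteq> I \<Longrightarrow> i \<in> I \<Longrightarrow> ldem i (lg J) = lg J \<longleftrightarrow> i \<in> J"
  using ldem_eq_iff [OF _ lg_closed] parabolic_descent [OF _ lg_parabolic] ldem_lg by blast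

text \<open>Downward induction on the length of \<open>x\<close>: unless \<open>x = w\<^sub>J\<close>, some \<open>s\<^sub>j x\<close> is longer. The
length of \<open>x w\<^sub>J\<close> exceeds that of \<open>s\<^sub>j x w\<^sub>J\<close> by at most one, and \<open>w\<^sub>J = x\<^sup>-\<^sup>1 (x w\<^sub>J)\<close> bounds it from
below.\<close>

lemma len_mult_lg:
  assumes "J \<subseteq> I" "x \<in> parabolic W s J"
  shows "len (x \<otimes> lg J) + len x = len (lg J)"
  using assms(2)
proof (induction "len (lg J) - len x" arbitrary: x rule: less_induct)
  case less
  have x: "x \<in> carrier W" using parabolic_closed [OF assms(1) less.prems] .
  show ?case
  proof (cases "\<forall>j \<in> J. ldem j x = x")
    case True
    then have "x = lg J" using lg_eqI [OF assms(1) less.prems] by simp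
    then show ?thesis using assms(1) by (simp add: lg_square)
  next
    case False
    then obtain j where j: "j \<in> J" "ldem j x \<noteq> x" by blast
    have jI: "j \<in> I" using j assms(1) by blast
    define y where "y = s j \<otimes> x"
    have xy: "x = s j \<otimes> y" and y: "y \<in> carrier W" using x jI by (simp_all add: y_def)
    have l: "len y = Suc (len x)"
      using j(2) ldem_cases [OF jI x] unfolding y_def by metis
    have yP: "y \<in> parabolic W s J"
      unfolding y_def by (rule parabolic_mult [OF parabolic_simple [OF j(1)] less.prems])
    have "len y \<le> len (lg J)" using longest_absorbing [OF assms(1)] yP by blast
    then have IH: "len (y \<otimes> lg J) + len y = len (lg J)" using less.hyps [OF _ yP] l by simp
    have "len (x \<otimes> lg J) \<le> Suc (len (y \<otimes> lg J))"
      using len_mult [of "s j" "y \<otimes> lg J"] xy y jI assms(1) by (simp add: m_assoc len_simple)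
    moreover have "len (lg J) \<le> len x + len (x \<otimes> lg J)"
      using len_mult [of "inv x" "x \<otimes> lg J"] x assms(1) by (simp flip: m_assoc)
    ultimately show ?thesis using IH l by linarith
  qed
qed

lemma len_lg_mult:
  assumes "J \<subseteq> I" "x \<in> parabolic W s J"
  shows "len (lg J \<otimes> x) + len x = len (lg J)"
proof -
  have x: "x \<in> carrier W" using parabolic_closed [OF assms] .
  have "len (inv (lg J \<otimes> x)) + len (inv x) = len (lg J)"
    using len_mult_lg [OF assms(1) parabolic_inv [OF assms]] x assms(1) by (simp add: inv_mult_group inv_lg)
  then show ?thesis using x assms(1) by simp
qed

text \<open>The element \<open>w\<^sub>J s\<^sub>j w\<^sub>J\<close> has length one by the two length formulas.\<close>

lemma lg_conj:
  assumes "J \<subseteq> I" "j \<in> J"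
  shows "\<exists>k \<in> I. s j \<otimes> lg J = lg J \<otimes> s k"
proof -
  have j: "j \<in> I" using assms by blast
  note P = parabolic_mult [OF parabolic_simple [OF assms(2)] lg_parabolic [OF assms(1)]]
  have "len (s j \<otimes> lg J) + 1 = len (lg J)"
    using len_mult_lg [OF assms(1) parabolic_simple [OF assms(2)]] len_simple [OF j] by simp
  then have "len (lg J \<otimes> (s j \<otimes> lg J)) = 1" using len_lg_mult [OF assms(1) P] by simp
  then obtain k where k: "k \<in> I" "lg J \<otimes> (s j \<otimes> lg J) = s k"
    using len_1 [of "lg J \<otimes> (s j \<otimes> lg J)"] j assms(1) by auto
  then have "lg J \<otimes> (lg J \<otimes> (s j \<otimes> lg J)) = lg J \<otimes> s k" by simp
  then show ?thesis using k(1) j assms(1) by (auto simp: lg_cancel)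
qed

abbreviation w0 :: 'w where "w0 \<equiv> lg I"

lemma len_w0:
  "x \<in> carrier W \<Longrightarrow> len (x \<otimes> w0) + len x = len w0"
  "x \<in> carrier W \<Longrightarrow> len (w0 \<otimes> x) + len x = len w0"
  using len_mult_lg [of I x] len_lg_mult [of I x] by (simp_all add: parabolic_all)

lemma ldem_mult_w0:
  assumes "i \<in> I" "x \<in> carrier W"
  shows "ldem i (x \<otimes> w0) = x \<otimes> w0 \<longleftrightarrow> ldem i x \<noteq> x"
proof -
  have sx: "s i \<otimes> x \<in> carrier W" using assms by simp
  have "ldem i (x \<otimes> w0) = x \<otimes> w0 \<longleftrightarrow> len (s i \<otimes> x \<otimes> w0) < len (x \<otimes> w0)"
    using assms by (simp add: ldem_eq_iff m_assoc)
  also have "\<dots> \<longleftrightarrow> len x < len (s i \<otimes> x)"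
    using len_w0(1) [OF assms(2)] len_w0(1) [OF sx] by linarith
  also have "\<dots> \<longleftrightarrow> ldem i x \<noteq> x"
  proof -
    have "len (s i \<otimes> x) \<noteq> len x" by (rule len_simple_cases [OF assms]) simp_all
    then show ?thesis using ldem_eq_iff [OF assms] by auto
  qed
  finally show ?thesis .
qed

section \<open>The elements \<open>w\<^sub>J w\<^sub>0\<close>\<close>

definition left_ascents :: "'w \<Rightarrow> 'i set" where
  "left_ascents w = {i \<in> I. ldem i w \<noteq> w}"

text \<open>The longest of the minimal length representatives of the cosets \<open>W\<^sub>J w\<close>.\<close>

definition max_rep :: "'i set \<Rightarrow> 'w" where
  "max_rep J = lg J \<otimes> w0"

text \<open>In a Weyl group this says that \<open>w\<^sup>-\<^sup>1\<close> maps a simple root to a simple root whenever it maps it to a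
positive root.\<close>

definition flippable :: "'w \<Rightarrow> bool" where
  "flippable w \<longleftrightarrow> w \<in> carrier W \<and> (\<forall>i \<in> left_ascents w. \<exists>k \<in> I. dem (s i) w = dem w (s k))"

lemma max_rep_closed [simp]: "J \<subseteq> I \<Longrightarrow> max_rep J \<in> carrier W"
  by (simp add: max_rep_def)

lemma left_ascents_max_rep: "J \<subseteq> I \<Longrightarrow> left_ascents (max_rep J) = J"
  using ldem_mult_w0 [OF _ lg_closed] ldem_lg_iff unfolding left_ascents_def max_rep_def by blast

lemma dem_simple_swap:
  assumes "i \<in> I" "k \<in> I" "w \<in> carrier W" "ldem i w \<noteq> w" "s i \<otimes> w = w \<otimes> s k"
  shows "dem (s i) w = dem w (s k)"
proof -
  have "ldem i w = s i \<otimes> w" "len w < len (s i \<otimes> w)"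
    using assms(3,4) by (auto simp: ldem_def split: if_splits)
  then show ?thesis using assms by (simp add: dem_simple_left dem_simple_right rdem_def)
qed

lemma flippable_max_rep:
  assumes "J \<subseteq> I"
  shows "flippable (max_rep J)"
  unfolding flippable_def
proof (intro conjI ballI)
  fix i assume i: "i \<in> left_ascents (max_rep J)"
  then have iJ: "i \<in> J" "i \<in> I" "ldem i (max_rep J) \<noteq> max_rep J" using assms left_ascents_max_rep by (auto simp: left_ascents_def)
  obtain k where k: "k \<in> I" "s i \<otimes> lg J = lg J \<otimes> s k" using lg_conj [OF assms iJ(1)] by blast
  obtain l where l: "l \<in> I" "s k \<otimes> w0 = w0 \<otimes> s l" using lg_conj [OF order_refl k(1)] by blast
  have "s i \<otimes> max_rep J = s i \<otimes> lg J \<otimes> w0" using iJ assms by (simp add: max_rep_def m_assoc)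
  also have "\<dots> = lg J \<otimes> (s k \<otimes> w0)" unfolding k(2) using k(1) assms by (simp add: m_assoc)
  also have "\<dots> = max_rep J \<otimes> s l" unfolding l(2) using l(1) assms by (simp add: max_rep_def m_assoc)
  finally show "\<exists>k \<in> I. dem (s i) (max_rep J) = dem (max_rep J) (s k)"
    using dem_simple_swap [OF iJ(2) l(1) max_rep_closed [OF assms] iJ(3)] l(1) by blast
qed (use assms in simp)

text \<open>A left ascent of \<open>x \<^bold>* y\<close> is one of \<open>x\<close>, so it passes through \<open>x\<close> and arrives at \<open>y\<close> as a generator
that again must act nontrivially; hence it also passes through \<open>y\<close>.\<close>

lemma flippable_dem:
  assumes "flippable x" "flippable y"
  shows "flippable (dem x y)"
  unfolding flippable_def
proof (intro conjI ballI)
  have xy: "x \<in> carrier W" "y \<in> carrier W" using assms by (auto simp: flippable_def)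
  then show "dem x y \<in> carrier W" by simp
  fix i assume "i \<in> left_ascents (dem x y)"
  then have i: "i \<in> I" "dem (s i) (dem x y) \<noteq> dem x y"
    using xy by (auto simp: left_ascents_def dem_simple_left)
  then have "dem (s i) x \<noteq> x" using xy by (metis dem_assoc simple_closed)
  then have "i \<in> left_ascents x" using i xy by (simp add: left_ascents_def dem_simple_left)
  then obtain j where j: "j \<in> I" "dem (s i) x = dem x (s j)"
    using assms(1) by (auto simp: flippable_def)
  have 1: "dem (s i) (dem x y) = dem x (dem (s j) y)"
    using i j xy dem_assoc [of "s i" x y] dem_assoc [of x "s j" y] by simp
  then have "j \<in> left_ascents y" using i(2) j xy by (auto simp: left_ascents_def dem_simple_left)
  then obtain k where k: "k \<in> I" "dem (s j) y = dem y (s k)"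
    using assms(2) by (auto simp: flippable_def)
  have "dem (s i) (dem x y) = dem (dem x y) (s k)"
    using 1 k xy dem_assoc [of x y "s k"] by simp
  then show "\<exists>k \<in> I. dem (s i) (dem x y) = dem (dem x y) (s k)" using k(1) by blast
qed

text \<open>The product \<open>v = w\<^sub>J \<^bold>* w\<close> equals \<open>w \<^bold>* b\<close> for some \<open>b\<close>, and is therefore fixed by all generators, so
\<open>v = w\<^sub>0\<close>. On the other hand \<open>v = x w\<close> with \<open>x \<in> W\<^sub>J\<close>. The left ascents \<open>J\<close> of \<open>w = x\<^sup>-\<^sup>1 w\<^sub>0\<close> are left
descents of \<open>x\<^sup>-\<^sup>1\<close>, which forces \<open>x\<^sup>-\<^sup>1 = w\<^sub>J\<close>.\<close>

lemma flippable_imp_max_rep: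
  assumes "flippable w"
  shows "w = max_rep (left_ascents w)"
proof -
  define J where "J = left_ascents w"
  have w: "w \<in> carrier W" using assms by (simp add: flippable_def)
  have J: "J \<subseteq> I" by (auto simp: J_def left_ascents_def)
  obtain u where u: "u \<in> lists J" "red (lg J) u" using parabolic_red [OF J lg_parabolic [OF J]] by blast
  define v where "v = dem (lg J) w"
  have vc: "v \<in> carrier W" using w J by (simp add: v_def)
  have vu: "v = ldems u w" using dem_ldems [OF u(2) w] by (simp add: v_def)
  have "\<exists>b \<in> carrier W. ldems u w = dem w b" using u(1)
  proof (induction u rule: list.induct)
    case Nil
    then show ?case using w by (intro bexI [of _ \<one>]) auto
  next
    case (Cons i u)
    then obtain b where b: "b \<in> carrier W" "ldems u w = dem w b" and i: "i \<in> left_ascents w"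
      by (auto simp: J_def)
    then obtain k where k: "k \<in> I" "dem (s i) w = dem w (s k)" using assms by (auto simp: flippable_def)
    have iI: "i \<in> I" using i by (simp add: left_ascents_def)
    have "ldems (i # u) w = dem (s i) (dem w b)" using b w iI by (simp add: dem_simple_left)
    also have "\<dots> = dem w (dem (s k) b)"
      using b w iI k dem_assoc [of "s i" w b] dem_assoc [of w "s k" b] by simp
    finally show ?case using b(1) k(1) by (intro bexI [of _ "dem (s k) b"]) auto
  qed
  then obtain b where b: "b \<in> carrier W" "v = dem w b" using vu by blast
  have "ldem i v = v" if i: "i \<in> I" for i
  proof (cases "i \<in> J")
    case True
    then have "dem (s i) (lg J) = lg J" using ldem_lg [OF J True] i J by (simp add: dem_simple_left)
    then show ?thesis
      using dem_assoc [of "s i" "lg J" w] i w J vc by (simp add: v_def dem_simple_left)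
  next
    case False
    then have "dem (s i) w = w" using i w by (simp add: J_def left_ascents_def dem_simple_left)
    then show ?thesis
      using dem_assoc [of "s i" w b] i w b vc by (simp add: dem_simple_left)
  qed
  then have v0: "v = w0" using vc by (intro lg_eqI) (auto simp: parabolic_all)
  obtain x where x: "x \<in> parabolic W s J" "v = x \<otimes> w" using ldems_parabolic [OF J w u(1)] vu by auto
  have xc: "x \<in> carrier W" using parabolic_closed [OF J x(1)] .
  have "inv x \<otimes> w0 = inv x \<otimes> (x \<otimes> w)" using v0 x(2) by simp
  then have wx: "w = inv x \<otimes> w0" using xc w by (simp flip: m_assoc)
  have "inv x = lg J"
  proof (rule lg_eqI [OF J parabolic_inv [OF J x(1)]])
    fix j assume j: "j \<in> J"
    then have "j \<in> I" "ldem j (inv x \<otimes> w0) \<noteq> inv x \<otimes> w0" using wx by (auto simp: J_def left_ascents_def)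
    then show "ldem j (inv x) = inv x" using ldem_mult_w0 [of j "inv x"] xc by simp
  qed
  then show ?thesis using wx by (simp add: max_rep_def J_def)
qed

section \<open>The operation on subsets\<close>

lemma star_eq:
  assumes "A \<subseteq> I" "B \<subseteq> I"
  shows "star W I s A B = left_ascents (dem (max_rep A) (max_rep B))"
    and "max_rep (star W I s A B) = dem (max_rep A) (max_rep B)"
proof -
  let ?K = "left_ascents (dem (max_rep A) (max_rep B))"
  have K: "?K \<subseteq> I" by (auto simp: left_ascents_def)
  have e: "dem (max_rep A) (max_rep B) = max_rep ?K"
    by (rule flippable_imp_max_rep [OF flippable_dem [OF flippable_max_rep flippable_max_rep]]) (rule assms)+
  have d: "demazure W I s (lg A \<otimes> w0) (lg B \<otimes> w0) = dem (max_rep A) (max_rep B)"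
    using demazure_eq [of "max_rep A" "max_rep B"] assms unfolding max_rep_def by simp
  have "star W I s A B = (THE K. K \<subseteq> I \<and> dem (max_rep A) (max_rep B) = max_rep K)"
    by (simp only: star_def d max_rep_def)
  also have "\<dots> = ?K"
  proof (rule the_equality)
    show "?K \<subseteq> I \<and> dem (max_rep A) (max_rep B) = max_rep ?K" using K e by simp
    fix L assume "L \<subseteq> I \<and> dem (max_rep A) (max_rep B) = max_rep L"
    then show "L = ?K" using left_ascents_max_rep [of L] by simp
  qed
  finally show *: "star W I s A B = ?K" .
  show "max_rep (star W I s A B) = dem (max_rep A) (max_rep B)" unfolding * by (rule e [symmetric])
qed

lemma star_subset_left: "A \<subseteq> I \<Longrightarrow> B \<subseteq> I \<Longrightarrow> star W I s A B \<subseteq> A"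
proof
  fix i assume AB: "A \<subseteq> I" "B \<subseteq> I" and "i \<in> star W I s A B"
  then have i: "i \<in> I" "dem (s i) (dem (max_rep A) (max_rep B)) \<noteq> dem (max_rep A) (max_rep B)"
    by (auto simp: star_eq left_ascents_def dem_simple_left)
  then have "dem (s i) (max_rep A) \<noteq> max_rep A" using AB dem_assoc [of "s i" "max_rep A" "max_rep B"] by auto
  then have "i \<in> left_ascents (max_rep A)" using i AB by (simp add: left_ascents_def dem_simple_left)
  then show "i \<in> A" using left_ascents_max_rep AB by simp
qed

text \<open>Inversion followed by conjugation with \<open>w\<^sub>0\<close>: each of the two maps turns \<open>w\<^sub>J w\<^sub>0\<close> into \<open>w\<^sub>0 w\<^sub>J\<close>, so
together they fix it.\<close>

definition twist :: "'w \<Rightarrow> 'w" where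
  "twist x = w0 \<otimes> inv x \<otimes> w0"

lemma twist_closed [simp]: "x \<in> carrier W \<Longrightarrow> twist x \<in> carrier W"
  by (simp add: twist_def)

lemma len_twist: "x \<in> carrier W \<Longrightarrow> len (twist x) = len x"
  using len_w0(1) [of "w0 \<otimes> inv x"] len_w0(2) [of "inv x"] by (simp add: twist_def)

lemma twist_mult: "x \<in> carrier W \<Longrightarrow> y \<in> carrier W \<Longrightarrow> twist (x \<otimes> y) = twist y \<otimes> twist x"
  by (simp add: twist_def m_assoc inv_mult_group lg_cancel)

lemma twist_ldem:
  assumes "i \<in> I"
  shows "\<exists>k \<in> I. \<forall>x \<in> carrier W. twist (ldem i x) = rdem k (twist x)"
proof -
  obtain k where k: "k \<in> I" "twist (s i) = s k"
    using len_1 [of "twist (s i)"] len_twist [of "s i"] assms len_simple by auto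
  have "twist (ldem i x) = rdem k (twist x)" if x: "x \<in> carrier W" for x
    using twist_mult [of "s i" x] len_twist [of "s i \<otimes> x"] len_twist [OF x] x assms k
    by (simp add: ldem_def rdem_def)
  then show ?thesis using k(1) by blast
qed

lemma twist_dem:
  assumes "x \<in> carrier W" "y \<in> carrier W"
  shows "twist (dem x y) = dem (twist y) (twist x)"
proof -
  obtain u where u: "red x u" using ex_red assms by blast
  have "twist (ldems u y) = dem (twist y) (twist (ldems u \<one>))" if "u \<in> lists I" for u
    using that
  proof (induction u rule: list.induct)
    case Nil
    have "twist \<one> = \<one>" by (simp add: twist_def lg_square)
    then show ?case using assms by simp
  next
    case (Cons i u)
    then have iu: "i \<in> I" "u \<in> lists I" by auto
    obtain k where k: "k \<in> I" "\<forall>x \<in> carrier W. twist (ldem i x) = rdem k (twist x)"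
      using twist_ldem [OF iu(1)] by blast
    have c: "ldems u y \<in> carrier W" "ldems u \<one> \<in> carrier W" using iu assms by auto
    have "twist (ldems (i # u) y) = dem (dem (twist y) (twist (ldems u \<one>))) (s k)"
      using k c Cons.IH [OF iu(2)] assms(2) by (simp add: dem_simple_right)
    also have "\<dots> = dem (twist y) (dem (twist (ldems u \<one>)) (s k))"
      using k(1) c assms(2) by (simp add: dem_assoc)
    also have "\<dots> = dem (twist y) (twist (ldems (i # u) \<one>))"
      using k c by (simp add: dem_simple_right)
    finally show ?case .
  qed
  from this [OF redD(1) [OF u]] show ?thesis
    using dem_ldems [OF u assms(2)] ldems_red [OF u] by simp
qed

lemma twist_max_rep: "J \<subseteq> I \<Longrightarrow> twist (max_rep J) = max_rep J"
  by (simp add: twist_def max_rep_def inv_mult_group inv_lg lg_cancel m_assoc lg_square)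

lemma star_commute:
  assumes "A \<subseteq> I" "B \<subseteq> I"
  shows "star W I s A B = star W I s B A"
proof -
  have sub: "star W I s A B \<subseteq> I" "star W I s B A \<subseteq> I"
    using star_subset_left assms by blast+
  have "max_rep (star W I s A B) = twist (max_rep (star W I s A B))" using twist_max_rep sub by simp
  also have "\<dots> = max_rep (star W I s B A)"
    using assms by (simp add: star_eq(2) twist_dem twist_max_rep)
  finally show ?thesis using left_ascents_max_rep sub by metis
qed

text \<open>The product \<open>w\<^sub>C w\<^sub>A = w\<^sub>A w\<^sub>C\<close> has length-additive factors in either order, so every index in \<open>A\<close> or
\<open>C\<close> is a left descent of it.\<close>

lemma lg_union:
  assumes "A \<subseteq> I" "C \<subseteq> I" "A \<inter> C = {}"
    and comm: "\<And>a c. a \<in> A \<Longrightarrow> c \<in> C \<Longrightarrow> s a \<otimes> s c = s c \<otimes> s a"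
  shows "lg (A \<union> C) = lg C \<otimes> lg A" "len (lg (A \<union> C)) = len (lg C) + len (lg A)"
proof -
  let ?z = "lg C \<otimes> lg A"
  note P = lg_parabolic [OF assms(1)] lg_parabolic [OF assms(2)]
  have z: "?z = lg A \<otimes> lg C" by (rule parabolic_commute [OF assms(1,2) comm P, symmetric])
  have AC: "A \<union> C \<subseteq> I" using assms by auto
  have mono: "parabolic W s J \<subseteq> parabolic W s (A \<union> C)" if "J \<subseteq> A \<union> C" for J
    unfolding parabolic_def using that by (intro mono_generate image_mono)
  have zP: "?z \<in> parabolic W s (A \<union> C)"
    using P mono by (intro parabolic_mult) auto
  have len_z: "len ?z = len (lg C) + len (lg A)"
    by (rule len_mult_disjoint [OF assms(1-3) P(2,1)])
  have desc: "ldem j (lg X \<otimes> lg Y) = lg X \<otimes> lg Y"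
    if "X \<subseteq> I" "Y \<subseteq> I" "X \<inter> Y = {}" "j \<in> X" for X Y j
  proof -
    have j: "j \<in> I" using that by blast
    have "len (s j \<otimes> lg X) < len (lg X)"
      using ldem_lg [OF that(1,4)] ldem_eq_iff [OF j] that(1) by simp
    moreover have "len (s j \<otimes> lg X \<otimes> lg Y) = len (s j \<otimes> lg X) + len (lg Y)"
      by (rule len_mult_disjoint [OF that(2,1) _ parabolic_mult [OF parabolic_simple [OF that(4)]
            lg_parabolic [OF that(1)]] lg_parabolic [OF that(2)]]) (use that(3) in auto)
    moreover have "len (lg X \<otimes> lg Y) = len (lg X) + len (lg Y)"
      by (rule len_mult_disjoint [OF that(2,1) _ lg_parabolic [OF that(1)] lg_parabolic [OF that(2)]])
        (use that(3) in auto)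
    ultimately show ?thesis using ldem_eq_iff [OF j] j that by (simp add: m_assoc)
  qed
  have "?z = lg (A \<union> C)"
  proof (rule lg_eqI [OF AC zP])
    fix j assume "j \<in> A \<union> C"
    then show "ldem j ?z = ?z"
      using desc [of C A j] desc [of A C j] assms(1-3) z by auto
  qed
  then show "lg (A \<union> C) = ?z" "len (lg (A \<union> C)) = len (lg C) + len (lg A)" using len_z by simp_all
qed

text \<open>The factor \<open>w\<^sub>C\<close> strips \<open>C\<close> off: \<open>w\<^sub>C \<^bold>* x\<^bsub>A \<union> C\<^esub> = w\<^sub>C w\<^sub>C w\<^sub>A w\<^sub>0 = x\<^sub>A\<close>, the lengths being additive. What \<open>D\<close>
contains beyond \<open>C\<close> has no effect, since \<open>w\<^sub>D = w\<^sub>D \<^bold>* w\<^sub>C\<close> and \<open>x\<^sub>A\<close> has no left ascent in \<open>D\<close>.\<close>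

lemma dem_lg_max_rep:
  assumes "A \<subseteq> I" "D \<subseteq> I" "A \<inter> D = {}" "C \<subseteq> D"
    and comm: "\<And>a c. a \<in> A \<Longrightarrow> c \<in> D \<Longrightarrow> s a \<otimes> s c = s c \<otimes> s a"
  shows "dem (lg D) (max_rep (A \<union> C)) = max_rep A"
proof -
  have C: "C \<subseteq> I" "A \<inter> C = {}" "A \<union> C \<subseteq> I" using assms by auto
  have un: "lg (A \<union> C) = lg C \<otimes> lg A" "len (lg (A \<union> C)) = len (lg C) + len (lg A)"
    by (rule lg_union [OF assms(1) C(1,2)]; use comm assms(4) in blast)+
  have CA: "lg C \<otimes> max_rep (A \<union> C) = max_rep A"
    unfolding max_rep_def un(1) using C assms(1) by (simp add: m_assoc lg_cancel)
  have "len (lg C \<otimes> max_rep (A \<union> C)) = len (lg C) + len (max_rep (A \<union> C))"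
    unfolding CA using len_w0(1) [of "lg A"] len_w0(1) [of "lg (A \<union> C)"] un(2) C assms(1)
    by (simp add: max_rep_def)
  then have 1: "dem (lg C) (max_rep (A \<union> C)) = max_rep A"
    using dem_eq_mult [of "lg C" "max_rep (A \<union> C)"] C CA by simp
  have 2: "dem (lg D) (lg C) = lg D"
    by (rule dem_absorb_right [OF C(1) lg_parabolic [OF C(1)]])
       (use assms(2,4) ldem_lg inv_lg in auto)
  have 3: "dem (lg D) (max_rep A) = max_rep A"
  proof (rule dem_absorb [OF assms(2) lg_parabolic [OF assms(2)]])
    show "max_rep A \<in> carrier W" using assms(1) by simp
    fix j assume "j \<in> D"
    then have "j \<in> I" "j \<notin> left_ascents (max_rep A)" using left_ascents_max_rep [OF assms(1)] assms(2,3) by auto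
    then show "ldem j (max_rep A) = max_rep A" by (simp add: left_ascents_def)
  qed
  have "dem (lg D) (max_rep (A \<union> C)) = dem (dem (lg D) (lg C)) (max_rep (A \<union> C))" by (simp add: 2)
  also have "\<dots> = max_rep A" using dem_assoc [of "lg D" "lg C" "max_rep (A \<union> C)"] C assms(2) 1 3 by simp
  finally show ?thesis .
qed

text \<open>The previous lemma is used twice with \<open>D = J - A\<close>: to write \<open>x\<^sub>A\<close> as \<open>w\<^sub>D \<^bold>* x\<^sub>J\<close>, and to evaluate
\<open>w\<^sub>D\<close> on \<open>x\<^sub>J \<^bold>* x\<^sub>B\<close>, which is \<open>x\<^sub>K\<close> with \<open>K = J \<star> B \<subseteq> J\<close>.\<close>

lemma star_restrict:
  assumes "J \<subseteq> I" "B \<subseteq> I" "A \<subseteq> J"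
    and comm: "\<And>a c. a \<in> A \<Longrightarrow> c \<in> J - A \<Longrightarrow> s a \<otimes> s c = s c \<otimes> s a"
  shows "star W I s A B = star W I s J B \<inter> A"
proof -
  let ?D = "J - A" and ?K = "star W I s J B"
  have I: "A \<subseteq> I" "?D \<subseteq> I" using assms by auto
  have K: "?K \<subseteq> J" "?K \<subseteq> I" using star_subset_left [OF assms(1,2)] assms(1) by auto
  have J: "J = A \<union> ?D" using assms(3) by auto
  have "dem (lg ?D) (max_rep (A \<union> ?D)) = max_rep A"
    by (rule dem_lg_max_rep) (use I comm in auto)
  then have A: "max_rep A = dem (lg ?D) (max_rep J)" using J by simp
  have "dem (max_rep A) (max_rep B) = dem (lg ?D) (max_rep ?K)"
    unfolding A star_eq(2) [OF assms(1,2)] using I assms(1,2) by (simp add: dem_assoc)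
  also have "?K = (?K \<inter> A) \<union> (?K \<inter> ?D)" using K by auto
  also have "dem (lg ?D) (max_rep ((?K \<inter> A) \<union> (?K \<inter> ?D))) = max_rep (?K \<inter> A)"
    by (rule dem_lg_max_rep) (use I comm in auto)
  finally have "max_rep (star W I s A B) = max_rep (?K \<inter> A)" using star_eq(2) [OF I(1) assms(2)] by simp
  moreover have "star W I s A B \<subseteq> I" "?K \<inter> A \<subseteq> I"
    using star_subset_left [OF I(1) assms(2)] I by auto
  ultimately show ?thesis using left_ascents_max_rep by metis
qed

section \<open>Connected components\<close>

lemma cox_edge_sym: "i \<in> I \<Longrightarrow> j \<in> I \<Longrightarrow> cox_edge W s i j \<longleftrightarrow> cox_edge W s j i"
  using ord_inv [of "s i \<otimes> s j"] by (auto simp: cox_edge_def cox_mat_def inv_mult_group)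

lemma no_edge_commute:
  assumes "i \<in> I" "j \<in> I" "\<not> cox_edge W s i j"
  shows "s i \<otimes> s j = s j \<otimes> s i"
proof (cases "i = j")
  case False
  then have "cox_mat W s i j = 1 \<or> cox_mat W s i j = 2" using assms(3) by (auto simp: cox_edge_def)
  then have "(s i \<otimes> s j) [^] (2 :: nat) = \<one>"
  proof
    assume "cox_mat W s i j = 1"
    then have "s i \<otimes> s j = \<one>" using ord_eq_1 [of "s i \<otimes> s j"] assms by (simp add: cox_mat_def)
    then show ?thesis by simp
  next
    assume "cox_mat W s i j = 2"
    then show ?thesis using pow_ord_eq_1 [of "s i \<otimes> s j"] assms by (simp add: cox_mat_def)
  qed
  then have "(s i \<otimes> s j) \<otimes> (s i \<otimes> s j) = \<one>" using assms by (simp add: numeral_2_eq_2)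
  then have "inv (s i \<otimes> s j) = s i \<otimes> s j" using assms by (intro inv_equality) auto
  then show ?thesis using assms by (simp add: inv_mult_group)
qed simp

abbreviation edges :: "'i set \<Rightarrow> ('i \<times> 'i) set" where
  "edges J \<equiv> {(i, j). i \<in> J \<and> j \<in> J \<and> cox_edge W s i j}"

lemma component_subset: "A \<in> cox_components W s J \<Longrightarrow> A \<subseteq> J"
  unfolding cox_components_def by (auto elim!: quotientE rtranclE)

lemma component_commute:
  assumes "J \<subseteq> I" "A \<in> cox_components W s J" "a \<in> A" "c \<in> J - A"
  shows "s a \<otimes> s c = s c \<otimes> s a"
proof -
  have a: "a \<in> J" using component_subset assms by blast
  obtain x where "A = (edges J)\<^sup>* `` {x}" using assms(2) unfolding cox_components_def by (auto elim: quotientE)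
  then have "(a, c) \<notin> edges J" using assms(3,4) by (auto intro: rtrancl_into_rtrancl)
  then show ?thesis using no_edge_commute a assms by blast
qed

lemma Union_components: "\<Union> (cox_components W s J) = J"
  using component_subset [of _ J] by (auto simp: cox_components_def quotient_def)

text \<open>Reachability is reflexive on the whole type and not only on \<open>J\<close>, so it is treated as an
equivalence relation on the whole type; the components are those of its classes that meet \<open>J\<close>.\<close>

lemma components_disjoint:
  assumes "J \<subseteq> I" "A \<in> cox_components W s J" "B \<in> cox_components W s J" "A \<noteq> B"
  shows "A \<inter> B = {}"
proof -
  have "sym (edges J)" using cox_edge_sym assms(1) by (auto simp: sym_def)
  then have "equiv UNIV ((edges J)\<^sup>*)"
    by (intro equivI) (auto simp: refl_rtrancl trans_rtrancl sym_rtrancl)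
  moreover have "A \<in> UNIV // (edges J)\<^sup>*" "B \<in> UNIV // (edges J)\<^sup>*"
    using assms unfolding cox_components_def quotient_def by auto
  ultimately show ?thesis using quotient_disj assms(4) by blast
qed

lemma star_components:
  assumes "J \<subseteq> I" "K \<subseteq> I" "A \<in> cox_components W s J" "B \<in> cox_components W s K"
  shows "star W I s A B = star W I s J K \<inter> (A \<inter> B)"
proof -
  have AB: "A \<subseteq> J" "B \<subseteq> K" using component_subset assms by auto
  then have "A \<subseteq> I" "B \<subseteq> I" using assms by auto
  have "star W I s A B = star W I s B A" by (rule star_commute) fact+
  also have "\<dots> = star W I s K A \<inter> B"
    by (rule star_restrict [OF assms(2) _ AB(2) component_commute [OF assms(2,4)]]) fact
  also have "star W I s K A = star W I s A K" by (rule star_commute) fact+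
  also have "\<dots> = star W I s J K \<inter> A"
    by (rule star_restrict [OF assms(1,2) AB(1) component_commute [OF assms(1,3)]])
  finally show ?thesis by auto
qed

end

theorem mainTheorem9:
  fixes W :: "('w, 'b) monoid_scheme" and I :: "'i set" and s :: "'i \<Rightarrow> 'w"
    and J\<^sub>1 J\<^sub>2 :: "'i set"
  assumes "coxeter_group W I s" and "finite (carrier W)"
    and "J\<^sub>1 \<subseteq> I" and "J\<^sub>2 \<subseteq> I"
  shows "star W I s J\<^sub>1 J\<^sub>2 =
      (\<Union>(A, B) \<in> cox_components W s J\<^sub>1 \<times> cox_components W s J\<^sub>2. star W I s A B)
    \<and> disjoint_family_on (\<lambda>(A, B). star W I s A B)
        (cox_components W s J\<^sub>1 \<times> cox_components W s J\<^sub>2)"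
proof -
  interpret finite_coxeter_group W I s
    using assms(1,2) by (simp add: finite_coxeter_group_def finite_coxeter_group_axioms_def)
  let ?C1 = "cox_components W s J\<^sub>1" and ?C2 = "cox_components W s J\<^sub>2"
  let ?K = "star W I s J\<^sub>1 J\<^sub>2"
  note comp = star_components [OF assms(3,4)]
  have "?K \<subseteq> J\<^sub>1" by (rule star_subset_left [OF assms(3,4)])
  moreover have "?K \<subseteq> J\<^sub>2"
    using star_subset_left [OF assms(4,3)] star_commute [OF assms(3,4)] by simp
  ultimately have "?K = ?K \<inter> (\<Union>?C1 \<inter> \<Union>?C2)" by (auto simp: Union_components)
  also have "\<dots> = (\<Union>(A, B) \<in> ?C1 \<times> ?C2. ?K \<inter> (A \<inter> B))" by blast
  also have "\<dots> = (\<Union>(A, B) \<in> ?C1 \<times> ?C2. star W I s A B)" using comp by (intro SUP_cong) auto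
  finally have un: "?K = (\<Union>(A, B) \<in> ?C1 \<times> ?C2. star W I s A B)" .
  have "star W I s A B \<inter> star W I s A' B' = {}"
    if "A \<in> ?C1" "B \<in> ?C2" "A' \<in> ?C1" "B' \<in> ?C2" "(A, B) \<noteq> (A', B')" for A B A' B'
    using components_disjoint [OF assms(3), of A A'] components_disjoint [OF assms(4), of B B']
      comp [of A B] comp [of A' B'] that by blast
  then have "disjoint_family_on (\<lambda>(A, B). star W I s A B) (?C1 \<times> ?C2)"
    unfolding disjoint_family_on_def by auto
  with un show ?thesis by blast
qed

end
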